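(* Let $\beta>-1$, let $d$ be an $\mathbb{N}$-valued random variable, and let $(P_n)$ be the max-choice Mori preferential attachment tree model with parameters $\beta$ and $d$, with maximal degree $M(n)$ at time $n$. Then there exist random variables $N$ and $K$, finite almost surely, such that at any time $n\ge N$ one has $\deg v_K(n)=M(n)$ and $M(n)>\deg v_i(n)$ for every $i\neq K$ (with $v_i$ a vertex of $P_n$).
   Context: Max-choice Mori preferential attachment tree model with parameters $\beta>-1$ and $d$ (an $\mathbb{N}$-valued random variable): let $d_1,d_2,\dots$ be i.i.d. copies of $d$ and let $v_1,v_2,\dots$ be a fixed sequence of distinct vertices. $P_0$ is the single vertex $v_1$ with no edges; $P_1$ is the tree with vertices $v_1,v_2$ and one edge between them. For $n\ge 1$, given $P_n$ (a tree on $v_1,\dots,v_{n+1}$ with $n$ edges), let $\deg v_i(n)$ be the degree of $v_i$ in $P_n$ and $\mathcal{F}_n=\sigma\{E(P_1),\dots,E(P_n)\}$. The variable $d_n$ is independent of $\mathcal{F}_n$. Given $\mathcal{F}_n$ and $d_n$, sample vertices $X_n^1,\dots,X_n^{d_n}$ i.i.d. from $\{v_1,\dots,v_{n+1}\}$ with $$\mathbb{P}(X_n^1=v_i\mid\mathcal{F}_n)=\frac{\deg v_i(n)+\beta}{(2+\beta)n+\beta}.$$ Let $Y_n$ be whichever of $X_n^1,\dots,X_n^{d_n}$ has the largest degree in $P_n$, ties being broken by an independent fair random choice among the sampled vertices of largest degree. Then $P_{n+1}$ is obtained from $P_n$ by adding the vertex $v_{n+2}$ and the edge $\{v_{n+2},Y_n\}$.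 Let $M(n)=\max_i\deg v_i(n)$. *)

theory Defs
  imports "HOL-Probability.Probability"
begin

text \<open>
  Graphs on a vertex set \<open>V\<close> are given by their edge sets, an edge being the set of its two
  end points.
\<close>

definition vdegree :: "'v set set \<Rightarrow> 'v \<Rightarrow> nat" where
  "vdegree E x = card {e \<in> E. x \<in> e}"

definition max_degree :: "'v set \<Rightarrow> 'v set set \<Rightarrow> nat" where
  "max_degree V E = Max (vdegree E ` V)"

definition vertices :: "(nat \<Rightarrow> 'v) \<Rightarrow> nat \<Rightarrow> 'v set" where
  "vertices v n = v ` {1..n + 1}"

text \<open>
  The \<open>\<sigma>\<close>-algebras below are generated by maps into discrete spaces.
  \<open>history M E n\<close> is \<open>\<sigma>(E 1, \<dots>, E n)\<close>, and \<open>adjoin F f\<close> is \<open>\<sigma>(F, f)\<close>.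
\<close>

definition history :: "'w measure \<Rightarrow> (nat \<Rightarrow> 'w \<Rightarrow> 'e) \<Rightarrow> nat \<Rightarrow> 'w measure" where
  "history M E n = sigma (space M) {E k -` A \<inter> space M | k A. 1 \<le> k \<and> k \<le> n}"

definition adjoin :: "'w measure \<Rightarrow> ('w \<Rightarrow> 'b) \<Rightarrow> 'w measure" where
  "adjoin F f = sigma (space F) (sets F \<union> {f -` A \<inter> space F | A. True})"

text \<open>Conditional probability of an event given a sub-\<open>\<sigma>\<close>-algebra, as a random variable.\<close>

definition cprob :: "'w measure \<Rightarrow> 'w measure \<Rightarrow> ('w \<Rightarrow> bool) \<Rightarrow> 'w \<Rightarrow> real" where
  "cprob M F Q = real_cond_exp M F (indicator {\<omega> \<in> space M. Q \<omega>})"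

definition vertex_prob :: "real \<Rightarrow> nat \<Rightarrow> 'v set set \<Rightarrow> 'v \<Rightarrow> real" where
  "vertex_prob \<beta> n E x = (real (vdegree E x) + \<beta>) / ((2 + \<beta>) * real n + \<beta>)"

definition largest :: "'v set set \<Rightarrow> 'v list \<Rightarrow> 'v set" where
  "largest E xs = {x \<in> set xs. \<forall>y \<in> set xs. vdegree E y \<le> vdegree E x}"

text \<open>
  The max-choice Mori tree process, realised on a probability space \<open>M\<close>. \<open>D\<close> is the law of
  the random variable \<open>d\<close> of the model and \<open>d 1, d 2, \<dots>\<close> are its i.i.d. copies (the index 0
  of \<open>d\<close>, \<open>X\<close>, \<open>Y\<close> and \<open>v\<close> is not used). The tree \<open>P\<^sub>n\<close> has vertex set \<open>vertices v n\<close> and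
  edge set \<open>E n \<omega>\<close>; \<open>X n \<omega>\<close> is the list of the \<open>d n \<omega>\<close> vertices sampled at time \<open>n\<close>.
  The assumption \<open>X_law\<close> says that, given \<open>history M E n\<close> and \<open>d n\<close>, these are i.i.d. with
  weights \<open>vertex_prob\<close>; the assumption \<open>Y_law\<close> says that ties are broken by a uniform choice
  given \<open>history M E n\<close>, \<open>d n\<close> and the sample.
\<close>

locale max_choice_mori_tree = prob_space M
  for M :: "'w measure" and \<beta> :: real and D :: "nat pmf" and v :: "nat \<Rightarrow> 'v"
    and d :: "nat \<Rightarrow> 'w \<Rightarrow> nat" and X :: "nat \<Rightarrow> 'w \<Rightarrow> 'v list" and Y :: "nat \<Rightarrow> 'w \<Rightarrow> 'v"
    and E :: "nat \<Rightarrow> 'w \<Rightarrow> 'v set set" +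
  assumes v_distinct: "inj_on v {1..}"
    and d_pos: "\<And>n \<omega>. n \<ge> 1 \<Longrightarrow> \<omega> \<in> space M \<Longrightarrow> d n \<omega> \<ge> 1"
    and d_indep: "indep_vars (\<lambda>_. count_space UNIV) d {1..}"
    and d_law: "\<And>n. n \<ge> 1 \<Longrightarrow> distr M (count_space UNIV) (d n) = measure_pmf D"
    and d_indep_history: "\<And>n. n \<ge> 1 \<Longrightarrow>
      indep_set (sets (history M E n)) {d n -` A \<inter> space M | A. True}"
    and X_measurable: "\<And>n. n \<ge> 1 \<Longrightarrow> X n \<in> measurable M (count_space UNIV)"
    and X_length: "\<And>n \<omega>. n \<ge> 1 \<Longrightarrow> \<omega> \<in> space M \<Longrightarrow> length (X n \<omega>) = d n \<omega>"
    and X_vertices: "\<And>n \<omega>. n \<ge> 1 \<Longrightarrow> \<omega> \<in> space M \<Longrightarrow> set (X n \<omega>) \<subseteq> vertices v n"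
    and X_law: "\<And>n xs. n \<ge> 1 \<Longrightarrow> set xs \<subseteq> vertices v n \<Longrightarrow>
      AE \<omega> in M. d n \<omega> = length xs \<longrightarrow>
        cprob M (adjoin (history M E n) (d n)) (\<lambda>\<omega>. X n \<omega> = xs) \<omega> =
        (\<Prod>x\<leftarrow>xs. vertex_prob \<beta> n (E n \<omega>) x)"
    and Y_measurable: "\<And>n. n \<ge> 1 \<Longrightarrow> Y n \<in> measurable M (count_space UNIV)"
    and Y_largest: "\<And>n \<omega>. n \<ge> 1 \<Longrightarrow> \<omega> \<in> space M \<Longrightarrow> Y n \<omega> \<in> largest (E n \<omega>) (X n \<omega>)"
    and Y_law: "\<And>n y. n \<ge> 1 \<Longrightarrow> y \<in> vertices v n \<Longrightarrow>
      AE \<omega> in M. y \<in> largest (E n \<omega>) (X n \<omega>) \<longrightarrow>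
        cprob M (adjoin (adjoin (history M E n) (d n)) (X n)) (\<lambda>\<omega>. Y n \<omega> = y) \<omega> =
        1 / real (card (largest (E n \<omega>) (X n \<omega>)))"
    and E_0: "\<And>\<omega>. \<omega> \<in> space M \<Longrightarrow> E 0 \<omega> = {}"
    and E_1: "\<And>\<omega>. \<omega> \<in> space M \<Longrightarrow> E 1 \<omega> = {{v 1, v 2}}"
    and E_Suc: "\<And>n \<omega>. n \<ge> 1 \<Longrightarrow> \<omega> \<in> space M \<Longrightarrow>
      E (n + 1) \<omega> = insert {v (n + 2), Y n \<omega>} (E n \<omega>)"

end

theory Submission imports Defs begin

text \<open>
  For two vertices of degrees \<open>a\<close> and \<open>b\<close> consider \<open>f a b = \<Gamma>(a + b + 2\<beta>) / (\<Gamma>(a + \<beta>) \<Gamma>(b + \<beta>) 2^(a + b))\<close>.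
  It is a martingale for the Polya urn with weights \<open>a + \<beta>\<close> and \<open>b + \<beta>\<close>, and it decreases when the larger
  degree grows; as the max-choice rule favours the larger degree even more than the urn does, it is a
  supermartingale here. On the diagonal \<open>f a a\<close> tends to infinity, while \<open>f m 1\<close> decays geometrically.

  With \<open>m\<close> the maximal degree at time \<open>n\<close>, sum \<open>f m (deg x)\<close> over all vertices \<open>x\<close> except one leader and
  add \<open>n * f m 1\<close>, which pays for the vertices still to come: since \<open>m\<close> grows at rate at least
  \<open>(m + \<beta>) / ((2 + \<beta>) n + \<beta>)\<close>, the sum is a nonnegative supermartingale as soon as \<open>m - 1 \<ge> 4 (2 + \<beta>)\<close>.
  Hence it stays bounded almost surely, whereas a tie for the maximal degree makes it at least \<open>f m m\<close>.
  As \<open>m\<close> tends to infinity, ties stop; and without ties the leader cannot change.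
\<close>

section \<open>The urn kernel\<close>

text \<open>This is the reciprocal of the Beta function at \<open>a + \<beta>\<close>,
  \<open>b + \<beta>\<close>, divided by \<open>2 ^ (a + b)\<close>. The power of 2 makes it an urn
  martingale: each of the two possible draws contributes exactly half of the current value.\<close>

definition urn_kernel :: "real \<Rightarrow> nat \<Rightarrow> nat \<Rightarrow> real" where
  "urn_kernel \<beta> a b = Gamma (real a + real b + 2 * \<beta>) / (Gamma (real a + \<beta>) * Gamma (real b + \<beta>) * 2 ^ (a + b))"

lemma urn_kernel_pos:
  assumes "\<beta> > -1" "a \<ge> 1" "b \<ge> 1"
  shows "urn_kernel \<beta> a b > 0"
proof -
  have "real a \<ge> 1" "real b \<ge> 1" using assms by auto
  then show ?thesis
    unfolding urn_kernel_def using assms(1) by (intro divide_pos_pos mult_pos_pos Gamma_real_pos) auto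
qed

lemma urn_kernel_commute: "urn_kernel \<beta> a b = urn_kernel \<beta> b a"
  by (simp add: urn_kernel_def add_ac mult_ac)

text \<open>The Gamma recurrence gives the factor
  \<open>(a + b + 2 * \<beta>) / (2 * (b + \<beta>))\<close>. Writing it as one plus a correction
  shows the sign: the kernel grows when the smaller degree catches up.\<close>

lemma urn_kernel_Suc_right:
  assumes "\<beta> > -1" "a \<ge> 1" "b \<ge> 1"
  shows "urn_kernel \<beta> a (Suc b) = urn_kernel \<beta> a b * (1 + (real a - real b) / (2 * (real b + \<beta>)))"
proof -
  have ab: "real a \<ge> 1" "real b \<ge> 1" using assms by auto
  have pos: "real b + \<beta> > 0" "real a + \<beta> > 0" "real a + real b + 2 * \<beta> > 0"
    using assms(1) ab by linarith+
  have nz: "real b + \<beta> \<notin> \<int>\<^sub>\<le>\<^sub>0" "real a + real b + 2 * \<beta> \<notin> \<int>\<^sub>\<le>\<^sub>0"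
    using pos by (auto dest: nonpos_Ints_nonpos)
  have "Gamma (real a + real (Suc b) + 2 * \<beta>) = (real a + real b + 2 * \<beta>) * Gamma (real a + real b + 2 * \<beta>)"
    using Gamma_plus1[OF nz(2)] by (simp add: add_ac)
  moreover have "Gamma (real (Suc b) + \<beta>) = (real b + \<beta>) * Gamma (real b + \<beta>)"
    using Gamma_plus1[OF nz(1)] by (simp add: add_ac)
  moreover have "1 + (real a - real b) / (2 * (real b + \<beta>)) = (real a + real b + 2 * \<beta>) / (2 * (real b + \<beta>))"
    using pos by (simp add: field_simps)
  ultimately show ?thesis
    unfolding urn_kernel_def by (simp add: field_simps)
qed

lemma urn_kernel_Suc_left:
  assumes "\<beta> > -1" "a \<ge> 1" "b \<ge> 1"
  shows "urn_kernel \<beta> (Suc a) b = urn_kernel \<beta> a b * (1 - (real a - real b) / (2 * (real a + \<beta>)))"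
proof -
  have "urn_kernel \<beta> (Suc a) b = urn_kernel \<beta> a b * (1 + (real b - real a) / (2 * (real a + \<beta>)))"
    using urn_kernel_Suc_right[OF assms(1,3,2)] by (simp add: urn_kernel_commute)
  then show ?thesis by (simp add: diff_divide_distrib)
qed

text \<open>The first step away from \<open>(a, a)\<close> leaves the kernel unchanged, since the
  correction vanishes for equal degrees; only the second step, back to the diagonal,
  contributes.\<close>

lemma urn_kernel_Suc_diagonal:
  assumes "\<beta> > -1" "a \<ge> 1"
  shows "urn_kernel \<beta> (Suc a) (Suc a) = urn_kernel \<beta> a a * (1 + 1 / (2 * (real a + \<beta>)))"
  using urn_kernel_Suc_right[of \<beta> "Suc a" a] urn_kernel_Suc_left[of \<beta> a a] assms by simp

text \<open>The increments along the diagonal are at least a constant times \<open>1 / a\<close>, so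
  comparison with the harmonic series gives divergence.\<close>

lemma urn_kernel_diagonal_at_top:
  assumes "\<beta> > -1"
  shows "filterlim (\<lambda>a. urn_kernel \<beta> a a) at_top sequentially"
proof -
  \<comment> \<open>Chosen so that \<open>c / a\<close> is at most the diagonal increment at
    \<open>a\<close>: for \<open>a \<ge> 1\<close>, \<open>a + \<beta>\<close> is at most
    \<open>(1 + \<bar>\<beta>\<bar>) * a\<close>.\<close>
  define c where "c = urn_kernel \<beta> 1 1 / (2 * (1 + \<bar>\<beta>\<bar>))"
  have k1: "urn_kernel \<beta> 1 1 > 0" using urn_kernel_pos[of \<beta> 1 1] assms by simp
  then have c: "c > 0" by (simp add: c_def add_pos_nonneg)
  \<comment> \<open>The constant lower bound is carried along because each increment is proportional
    to the current value.\<close>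
  have ge: "urn_kernel \<beta> (Suc a) (Suc a) \<ge> urn_kernel \<beta> 1 1 \<and> urn_kernel \<beta> (Suc a) (Suc a) \<ge> c * harm a" for a
  proof (induction a)
    case 0
    then show ?case using k1 by (simp add: harm_expand)
  next
    case (Suc a)
    have p: "real (Suc a) + \<beta> > 0" using assms by simp
    have "c * inverse (real (Suc a)) = urn_kernel \<beta> 1 1 * (1 / (2 * ((1 + \<bar>\<beta>\<bar>) * real (Suc a))))"
      by (simp add: c_def field_simps)
    also have "\<dots> \<le> urn_kernel \<beta> 1 1 * (1 / (2 * (real (Suc a) + \<beta>)))"
    proof -
      have "real (Suc a) + \<beta> \<le> real (Suc a) + \<bar>\<beta>\<bar> * real (Suc a)"
        using mult_left_mono[of 1 "real (Suc a)" "\<bar>\<beta>\<bar>"] by simp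
      then show ?thesis
        using p k1 by (intro mult_left_mono divide_left_mono mult_pos_pos) (auto simp: algebra_simps)
    qed
    also have "\<dots> \<le> urn_kernel \<beta> (Suc a) (Suc a) * (1 / (2 * (real (Suc a) + \<beta>)))"
      using Suc p by (intro mult_right_mono) auto
    finally have step: "c * inverse (real (Suc a)) \<le> urn_kernel \<beta> (Suc a) (Suc a) * (1 / (2 * (real (Suc a) + \<beta>)))" .
    have eq: "urn_kernel \<beta> (Suc (Suc a)) (Suc (Suc a)) =
      urn_kernel \<beta> (Suc a) (Suc a) + urn_kernel \<beta> (Suc a) (Suc a) * (1 / (2 * (real (Suc a) + \<beta>)))"
      using urn_kernel_Suc_diagonal[of \<beta> "Suc a"] assms by (simp add: algebra_simps)
    have "c * inverse (real (Suc a)) > 0" using c by simp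
    moreover have "c * harm (Suc a) = c * harm a + c * inverse (real (Suc a))"
      by (simp add: harm_Suc algebra_simps)
    ultimately show ?case using Suc step eq by linarith
  qed
  have "filterlim (\<lambda>a. c * harm a) at_top sequentially"
    using c harm_at_top by (rule filterlim_tendsto_pos_mult_at_top[OF tendsto_const])
  then have "filterlim (\<lambda>a. urn_kernel \<beta> (Suc a) (Suc a)) at_top sequentially"
    by (rule filterlim_at_top_mono) (use ge in auto)
  then show ?thesis
    by (subst (asm) filterlim_sequentially_Suc)
qed

section \<open>Recursive trees\<close>

text \<open>The invariant that stands in for being a tree. The degree sum is the handshake count for
  \<open>n\<close> edges, and containment in the vertex set makes every edge at the next vertex a
  new one.\<close>

definition recursive_tree :: "(nat \<Rightarrow> 'v) \<Rightarrow> nat \<Rightarrow> 'v set set \<Rightarrow> bool" where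
  "recursive_tree v n e \<longleftrightarrow> e \<subseteq> Pow (vertices v n) \<and> (\<forall>x \<in> vertices v n. 1 \<le> vdegree e x) \<and>
     (\<Sum>x \<in> vertices v n. vdegree e x) = 2 * n"

lemma finite_vertices [simp]: "finite (vertices v n)"
  by (simp add: vertices_def)

lemma vertices_nonempty [simp]: "vertices v n \<noteq> {}"
  by (auto simp: vertices_def)

lemma vertices_Suc: "vertices v (Suc n) = insert (v (n + 2)) (vertices v n)"
  by (simp add: vertices_def atLeastAtMostSuc_conv)

lemma new_vertex:
  assumes "inj_on v {1..}" shows "v (n + 2) \<notin> vertices v n"
proof
  assume "v (n + 2) \<in> vertices v n"
  then obtain i where "i \<in> {1..n + 1}" "v (n + 2) = v i" by (auto simp: vertices_def)
  with inj_onD[OF assms, of "n + 2" i] show False by simp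
qed

lemma recursive_tree_finite: "recursive_tree v n e \<Longrightarrow> finite e"
  by (auto simp: recursive_tree_def intro: finite_subset)

lemma vdegree_insert:
  assumes "finite e" "a \<notin> e"
  shows "vdegree (insert a e) x = vdegree e x + (if x \<in> a then 1 else 0)"
proof -
  have "{b \<in> insert a e. x \<in> b} = (if x \<in> a then insert a {b \<in> e. x \<in> b} else {b \<in> e. x \<in> b})"
    by auto
  then show ?thesis using assms by (simp add: vdegree_def)
qed

context
  fixes v :: "nat \<Rightarrow> 'v" and n :: nat and e :: "'v set set" and y :: 'v
  assumes inj: "inj_on v {1..}" and tree: "recursive_tree v n e" and y: "y \<in> vertices v n"
begin

lemma new_edge: "{v (n + 2), y} \<notin> e"
  using new_vertex[OF inj, of n] tree by (auto simp: recursive_tree_def)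

lemma vdegree_new: "vdegree (insert {v (n + 2), y} e) (v (n + 2)) = 1"
proof -
  have empty: "{a \<in> e. v (n + 2) \<in> a} = {}"
    using new_vertex[OF inj, of n] tree by (auto simp: recursive_tree_def)
  have "vdegree e (v (n + 2)) = 0" unfolding vdegree_def empty by simp
  then show ?thesis
    using vdegree_insert[OF recursive_tree_finite[OF tree] new_edge] by simp
qed

lemma vdegree_old:
  "x \<in> vertices v n \<Longrightarrow> vdegree (insert {v (n + 2), y} e) x = vdegree e x + (if x = y then 1 else 0)"
  using vdegree_insert[OF recursive_tree_finite[OF tree] new_edge] new_vertex[OF inj, of n] by auto

lemma recursive_tree_Suc: "recursive_tree v (Suc n) (insert {v (n + 2), y} e)"
proof -
  have "(\<Sum>x \<in> vertices v n. vdegree (insert {v (n + 2), y} e) x) = (\<Sum>x \<in> vertices v n. vdegree e x) + 1"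
    using y by (simp only: vdegree_old sum.distrib cong: sum.cong) simp
  then have "(\<Sum>x \<in> vertices v (Suc n). vdegree (insert {v (n + 2), y} e) x) = 2 * Suc n"
    using tree new_vertex[OF inj, of n] vdegree_new by (simp add: vertices_Suc recursive_tree_def)
  moreover have "\<forall>x \<in> vertices v (Suc n). 1 \<le> vdegree (insert {v (n + 2), y} e) x"
    using tree vdegree_new vdegree_old by (auto simp: vertices_Suc recursive_tree_def)
  ultimately show ?thesis
    using tree y by (auto simp: recursive_tree_def vertices_Suc)
qed

end

lemma max_degree_ge: "x \<in> vertices v n \<Longrightarrow> vdegree e x \<le> max_degree (vertices v n) e"
  by (simp add: max_degree_def)

lemma max_degree_attained: "\<exists>x \<in> vertices v n. vdegree e x = max_degree (vertices v n) e"
  proof -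
  have "max_degree (vertices v n) e \<in> vdegree e ` vertices v n"
    unfolding max_degree_def by (intro Max_in) auto
  then show ?thesis by auto
qed

lemma max_degree_eqI:
  "x \<in> vertices v n \<Longrightarrow> vdegree e x = m \<Longrightarrow> (\<And>z. z \<in> vertices v n \<Longrightarrow> vdegree e z \<le> m) \<Longrightarrow>
     max_degree (vertices v n) e = m"
  unfolding max_degree_def by (intro Max_eqI) auto

lemma max_degree_pos: "recursive_tree v n e \<Longrightarrow> 1 \<le> max_degree (vertices v n) e"
  using max_degree_attained[of v n e] by (auto simp: recursive_tree_def)

text \<open>Only \<open>y\<close> and the new leaf have changed degrees, and the leaf has degree 1,
  which never exceeds the old maximum. So the maximum moves exactly when \<open>y\<close> attains
  it.\<close>

lemma max_degree_insert:
  assumes "inj_on v {1..}" "recursive_tree v n e" "y \<in> vertices v n"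
  shows "max_degree (vertices v (Suc n)) (insert {v (n + 2), y} e) =
    (if vdegree e y = max_degree (vertices v n) e then Suc (max_degree (vertices v n) e)
     else max_degree (vertices v n) e)"
proof -
  note deg = vdegree_new[OF assms] vdegree_old[OF assms]
  note mp = max_degree_pos[OF assms(2)]
  obtain L where L: "L \<in> vertices v n" "vdegree e L = max_degree (vertices v n) e"
    using max_degree_attained[of v n e] by blast
  show ?thesis
  proof (cases "vdegree e y = max_degree (vertices v n) e")
    case True
    have "max_degree (vertices v (Suc n)) (insert {v (n + 2), y} e) = Suc (max_degree (vertices v n) e)"
    proof (rule max_degree_eqI)
      show "vdegree (insert {v (n + 2), y} e) y = Suc (max_degree (vertices v n) e)"
        using deg(2)[OF assms(3)] True by simp
      show "vdegree (insert {v (n + 2), y} e) z \<le> Suc (max_degree (vertices v n) e)"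
        if "z \<in> vertices v (Suc n)" for z
        using that deg(1) deg(2)[of z] max_degree_ge[of z v n e] by (auto simp: vertices_Suc)
    qed (use assms(3) in \<open>simp add: vertices_Suc\<close>)
    with True show ?thesis by simp
  next
    case False
    then have lt: "vdegree e y < max_degree (vertices v n) e"
      using max_degree_ge[OF assms(3), of e] by linarith
    have "max_degree (vertices v (Suc n)) (insert {v (n + 2), y} e) = max_degree (vertices v n) e"
    proof (rule max_degree_eqI)
      show "vdegree (insert {v (n + 2), y} e) L = max_degree (vertices v n) e"
        using deg(2)[OF L(1)] L(2) False by auto
      show "vdegree (insert {v (n + 2), y} e) z \<le> max_degree (vertices v n) e"
        if "z \<in> vertices v (Suc n)" for z
        using that deg(1) deg(2)[of z] max_degree_ge[of z v n e] lt mp by (auto simp: vertices_Suc)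
    qed (use L in \<open>simp add: vertices_Suc\<close>)
    with False show ?thesis by simp
  qed
qed

section \<open>The potential of a tree\<close>

text \<open>Subtracting the diagonal value removes one leader without selecting it, so the potential
  is a function of the edge set alone.\<close>

definition potential :: "real \<Rightarrow> (nat \<Rightarrow> 'v) \<Rightarrow> nat \<Rightarrow> 'v set set \<Rightarrow> real" where
  "potential \<beta> v n e = (let m = max_degree (vertices v n) e in
     (\<Sum>x \<in> vertices v n. urn_kernel \<beta> m (vdegree e x)) - urn_kernel \<beta> m m + real n * urn_kernel \<beta> m 1)"

lemma potential_nonneg:
  assumes "\<beta> > -1" "recursive_tree v n e"
  shows "potential \<beta> v n e \<ge> 0"
proof -
  let ?m = "max_degree (vertices v n) e"
  note mp = max_degree_pos[OF assms(2)]
  have k: "urn_kernel \<beta> ?m b > 0" if "b \<ge> 1" for b using urn_kernel_pos assms(1) mp that by blast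
  obtain L where L: "L \<in> vertices v n" "vdegree e L = ?m"
    using max_degree_attained[of v n e] by blast
  have "urn_kernel \<beta> ?m (vdegree e L) \<le> (\<Sum>x \<in> vertices v n. urn_kernel \<beta> ?m (vdegree e x))"
    using k assms(2) L by (intro member_le_sum) (auto simp: recursive_tree_def less_imp_le)
  then show ?thesis
    using L k[of 1] by (simp add: potential_def Let_def)
qed

text \<open>Of the two diagonal terms contributed by tied leaders, one survives the
  subtraction.\<close>

lemma potential_tie:
  assumes "\<beta> > -1" "recursive_tree v n e" "x \<in> vertices v n" "y \<in> vertices v n" "x \<noteq> y"
    "vdegree e x = max_degree (vertices v n) e" "vdegree e y = max_degree (vertices v n) e"
  shows "potential \<beta> v n e \<ge> urn_kernel \<beta> (max_degree (vertices v n) e) (max_degree (vertices v n) e)"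
proof -
  let ?m = "max_degree (vertices v n) e"
  note mp = max_degree_pos[OF assms(2)]
  have k: "urn_kernel \<beta> ?m b > 0" if "b \<ge> 1" for b using urn_kernel_pos assms(1) mp that by blast
  have "(\<Sum>x \<in> {x, y}. urn_kernel \<beta> ?m (vdegree e x)) \<le> (\<Sum>x \<in> vertices v n. urn_kernel \<beta> ?m (vdegree e x))"
    using k assms by (intro sum_mono2) (auto simp: recursive_tree_def less_imp_le)
  then show ?thesis
    using assms(5-7) mult_nonneg_nonneg[of "real n", OF _ less_imp_le[OF k[of 1]]]
    by (simp add: potential_def Let_def del: zero_le_mult_iff)
qed

lemma sum_vertex_weight:
  assumes "recursive_tree v n e" "inj_on v {1..}"
  shows "(\<Sum>x \<in> vertices v n. real (vdegree e x) + \<beta>) = (2 + \<beta>) * real n + \<beta>"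
proof -
  have "card (vertices v n) = n + 1"
    unfolding vertices_def by (subst card_image) (auto intro: inj_on_subset[OF assms(2)])
  moreover have "(\<Sum>x \<in> vertices v n. real (vdegree e x)) = 2 * real n"
    using assms(1) unfolding recursive_tree_def
    by (metis of_nat_mult of_nat_numeral of_nat_sum)
  ultimately show ?thesis by (simp add: sum.distrib algebra_simps)
qed

text \<open>
  \<open>q\<close> favours high degrees at least as much as preferential attachment does. It is not normalised:
  it is used for the joint probabilities of the choice and of an event of the past.
\<close>

definition degree_biased :: "real \<Rightarrow> (nat \<Rightarrow> 'v) \<Rightarrow> nat \<Rightarrow> 'v set set \<Rightarrow> ('v \<Rightarrow> real) \<Rightarrow> bool" where
  "degree_biased \<beta> v n e q \<longleftrightarrow> (\<forall>x \<in> vertices v n. 0 \<le> q x) \<and>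
     (\<forall>x \<in> vertices v n. \<forall>y \<in> vertices v n. vdegree e y \<le> vdegree e x \<longrightarrow>
        q y * (real (vdegree e x) + \<beta>) \<le> q x * (real (vdegree e y) + \<beta>))"

text \<open>Compare every vertex with the leader through the bias inequality and sum; the weights
  add up to the normalising constant of \<open>vertex_prob\<close>.\<close>

lemma leader_gain:
  assumes "\<beta> > -1" "inj_on v {1..}" "recursive_tree v n e" "degree_biased \<beta> v n e q"
    "L \<in> vertices v n" "vdegree e L = max_degree (vertices v n) e"
  shows "(real (max_degree (vertices v n) e) + \<beta>) * sum q (vertices v n) \<le> q L * ((2 + \<beta>) * real n + \<beta>)"
proof -
  have "(real (vdegree e L) + \<beta>) * sum q (vertices v n) = (\<Sum>y \<in> vertices v n. q y * (real (vdegree e L) + \<beta>))"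
    by (metis mult.commute sum_distrib_right)
  also have "\<dots> \<le> (\<Sum>y \<in> vertices v n. q L * (real (vdegree e y) + \<beta>))"
    using assms(4,5) max_degree_ge[of _ v n e] unfolding degree_biased_def assms(6)[symmetric]
    by (intro sum_mono) auto
  also have "\<dots> = q L * ((2 + \<beta>) * real n + \<beta>)"
    using sum_vertex_weight[OF assms(3,2)] by (simp flip: sum_distrib_left)
  finally show ?thesis using assms(6) by simp
qed

text \<open>The supermartingale inequality for one growth step, with unnormalised choice weights.
  The increment splits into the cost of leaves and the comparison of each vertex with the
  leader.\<close>

lemma potential_step:
  assumes \<beta>: "\<beta> > -1" and inj: "inj_on v {1..}" and tree: "recursive_tree v n e"
    and q: "degree_biased \<beta> v n e q"
    and large: "real (max_degree (vertices v n) e) - 1 \<ge> 4 * (2 + \<beta>)"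
  shows "(\<Sum>y \<in> vertices v n. q y * potential \<beta> v (Suc n) (insert {v (n + 2), y} e)) \<le>
    sum q (vertices v n) * potential \<beta> v n e"
proof -
  define m where "m = max_degree (vertices v n) e"
  define V where "V = vertices v n"
  define k where "k = vdegree e"
  \<comment> \<open>The mass of all choices that make the maximum grow, tied leaders
    included.\<close>
  define up where "up = (\<Sum>y \<in> V. if k y = m then q y else 0)"
  \<comment> \<open>The drop of the kernel sum when \<open>m\<close> is replaced by
    \<open>Suc m\<close>.\<close>
  define S where "S = (\<Sum>x \<in> V. urn_kernel \<beta> m (k x) * (real m - real (k x)) / (2 * (real m + \<beta>)))"
  have mp: "m \<ge> 1" using max_degree_pos[OF tree] by (simp add: m_def)
  have kp: "k x \<ge> 1" if "x \<in> V" for x using tree that by (auto simp: V_def k_def recursive_tree_def)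
  have km: "k x \<le> m" if "x \<in> V" for x using that max_degree_ge by (simp add: V_def k_def m_def)
  have mb: "real m + \<beta> > 0" using mp \<beta> by linarith
  have kb: "real (k x) + \<beta> > 0" if "x \<in> V" for x
    using kp[OF that] \<beta> by linarith
  have q0: "q x \<ge> 0" if "x \<in> V" for x using q that by (auto simp: degree_biased_def V_def)
  have fin: "finite V" by (simp add: V_def)
  have new: "v (n + 2) \<notin> V" using new_vertex[OF inj] by (simp add: V_def)
  have g: "urn_kernel \<beta> m 1 > 0" using urn_kernel_pos \<beta> mp by blast
  obtain L where L: "L \<in> V" "k L = m"
    using max_degree_attained[of v n e] unfolding m_def k_def V_def by blast
  have upL: "q L \<le> up"
    unfolding up_def using member_le_sum[of L V "\<lambda>y. if k y = m then q y else 0"] L q0 fin by auto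
  have bias: "q x * (real m + \<beta>) \<le> up * (real (k x) + \<beta>)" if "x \<in> V" for x
  proof -
    have "q x * (real m + \<beta>) \<le> q L * (real (k x) + \<beta>)"
      using q L that km[OF that] unfolding degree_biased_def V_def[symmetric] k_def by force
    also have "\<dots> \<le> up * (real (k x) + \<beta>)"
      using upL kb[OF that] by (intro mult_right_mono) auto
    finally show ?thesis .
  qed
  have pot: "potential \<beta> v n e = (\<Sum>x \<in> V. urn_kernel \<beta> m (k x)) - urn_kernel \<beta> m m + real n * urn_kernel \<beta> m 1"
    by (simp add: potential_def Let_def m_def k_def V_def)
  \<comment> \<open>The drop of a single leaf kernel when the maximum grows.\<close>
  define w where "w = urn_kernel \<beta> m 1 * ((real m - 1) / (2 * (real m + \<beta>)))"
  have g_up: "urn_kernel \<beta> (Suc m) 1 = urn_kernel \<beta> m 1 - w"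
    using urn_kernel_Suc_left[of \<beta> m 1] \<beta> mp by (simp add: w_def right_diff_distrib)
  \<comment> \<open>One of the two leaf charges is for the new vertex, the other for the increased
    factor \<open>real n\<close>. When the maximum grows, these \<open>n + 2\<close> leaf kernels
    drop by \<open>w\<close> each.\<close>
  have inc: "potential \<beta> v (Suc n) (insert {v (n + 2), y} e) - potential \<beta> v n e =
     2 * urn_kernel \<beta> m 1 + urn_kernel \<beta> m (k y) * (real m - real (k y)) / (2 * (real (k y) + \<beta>)) +
     (if k y = m then - S - real (n + 2) * w else 0)"
    if y: "y \<in> V" for y
  proof -
    note y' = y[unfolded V_def]
    define m' where "m' = (if k y = m then Suc m else m)"
    have m': "max_degree (vertices v (Suc n)) (insert {v (n + 2), y} e) = m'"
      using max_degree_insert[OF inj tree y'] by (simp add: m'_def m_def k_def)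
    have "(\<Sum>x \<in> V. urn_kernel \<beta> m' (vdegree (insert {v (n + 2), y} e) x)) =
      (\<Sum>x \<in> V. urn_kernel \<beta> m' (k x) + (if x = y then urn_kernel \<beta> m' (Suc (k y)) - urn_kernel \<beta> m' (k y) else 0))"
      using vdegree_old[OF inj tree y'] by (intro sum.cong) (auto simp: V_def k_def)
    also have "\<dots> = (\<Sum>x \<in> V. urn_kernel \<beta> m' (k x)) + (urn_kernel \<beta> m' (Suc (k y)) - urn_kernel \<beta> m' (k y))"
      using y fin by (simp add: sum.distrib)
    finally have pot': "potential \<beta> v (Suc n) (insert {v (n + 2), y} e) =
      (\<Sum>x \<in> V. urn_kernel \<beta> m' (k x)) + (urn_kernel \<beta> m' (Suc (k y)) - urn_kernel \<beta> m' (k y)) - urn_kernel \<beta> m' m'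
      + real (n + 2) * urn_kernel \<beta> m' 1"
      using new fin vdegree_new[OF inj tree y']
      unfolding potential_def m' Let_def unfolding vertices_Suc V_def[symmetric] by (simp add: algebra_simps)
    show ?thesis
    proof (cases "k y = m")
      case False
      then have "m' = m" by (simp add: m'_def)
      moreover have "urn_kernel \<beta> m (Suc (k y)) - urn_kernel \<beta> m (k y) =
          urn_kernel \<beta> m (k y) * (real m - real (k y)) / (2 * (real (k y) + \<beta>))"
        using urn_kernel_Suc_right[OF \<beta> mp kp[OF y]] by (simp add: algebra_simps)
      ultimately show ?thesis using False pot pot' by (simp add: algebra_simps)
    next
      case True
      then have m'': "m' = Suc m" by (simp add: m'_def)
      have "(\<Sum>x \<in> V. urn_kernel \<beta> (Suc m) (k x)) = (\<Sum>x \<in> V. urn_kernel \<beta> m (k x)) - S"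
        unfolding S_def sum_subtractf[symmetric]
        using urn_kernel_Suc_left[OF \<beta> mp kp] by (intro sum.cong) (auto simp: algebra_simps)
      \<comment> \<open>The term of a maximal \<open>y\<close> cancels against the subtracted
        diagonal value, before the step as well as after it; this identity accounts for the
        intermediate value.\<close>
      moreover have "urn_kernel \<beta> (Suc m) m = urn_kernel \<beta> m m"
        using urn_kernel_Suc_left[OF \<beta> mp mp] by simp
      ultimately show ?thesis
        using True pot pot'[unfolded m'' g_up] by (simp add: algebra_simps)
    qed
  qed
  have "(\<Sum>y \<in> V. q y * (potential \<beta> v (Suc n) (insert {v (n + 2), y} e) - potential \<beta> v n e)) =
     (\<Sum>y \<in> V. q y * (2 * urn_kernel \<beta> m 1)) +
     (\<Sum>y \<in> V. q y * (urn_kernel \<beta> m (k y) * (real m - real (k y)) / (2 * (real (k y) + \<beta>)))) +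
     (\<Sum>y \<in> V. (if k y = m then q y else 0) *
        (- S - real (n + 2) * w))"
    unfolding sum.distrib[symmetric] using inc by (intro sum.cong) (auto simp: algebra_simps)
  also have "\<dots> = (sum q V * (2 * urn_kernel \<beta> m 1) - up * real (n + 2) * w)
     + ((\<Sum>y \<in> V. q y * (urn_kernel \<beta> m (k y) * (real m - real (k y)) / (2 * (real (k y) + \<beta>)))) - up * S)"
    unfolding sum_distrib_right[symmetric] up_def[symmetric] by (simp add: algebra_simps)
  \<comment> \<open>The brackets are nonpositive separately: the first needs a large maximal degree,
    the second only the bias towards high degrees.\<close>
  also have "\<dots> \<le> 0 + 0"
  proof (rule add_mono)
    have "(\<Sum>y \<in> V. q y * (urn_kernel \<beta> m (k y) * (real m - real (k y)) / (2 * (real (k y) + \<beta>))))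
      \<le> (\<Sum>y \<in> V. up * (urn_kernel \<beta> m (k y) * (real m - real (k y)) / (2 * (real m + \<beta>))))"
    proof (rule sum_mono)
      fix y assume y: "y \<in> V"
      \<comment> \<open>For pure preferential attachment with a single leader this is an equality;
        it is the martingale identity of the urn.\<close>
      have "q y / (real (k y) + \<beta>) \<le> up / (real m + \<beta>)"
        using bias[OF y] kb[OF y] mb by (simp add: field_simps)
      moreover have "urn_kernel \<beta> m (k y) * (real m - real (k y)) / 2 \<ge> 0"
        using urn_kernel_pos[OF \<beta> mp kp[OF y]] km[OF y] by simp
      ultimately have "(urn_kernel \<beta> m (k y) * (real m - real (k y)) / 2) * (q y / (real (k y) + \<beta>)) \<le>
         (urn_kernel \<beta> m (k y) * (real m - real (k y)) / 2) * (up / (real m + \<beta>))"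
        by (rule mult_left_mono)
      then show "q y * (urn_kernel \<beta> m (k y) * (real m - real (k y)) / (2 * (real (k y) + \<beta>))) \<le>
         up * (urn_kernel \<beta> m (k y) * (real m - real (k y)) / (2 * (real m + \<beta>)))"
        by (simp add: field_simps)
    qed
    then show "(\<Sum>y \<in> V. q y * (urn_kernel \<beta> m (k y) * (real m - real (k y)) / (2 * (real (k y) + \<beta>)))) - up * S \<le> 0"
      by (simp add: S_def sum_distrib_left)
    have up0: "up \<ge> 0" using upL q0[OF L(1)] by linarith
    have "(real m + \<beta>) * sum q V \<le> q L * ((2 + \<beta>) * real n + \<beta>)"
      using leader_gain[OF \<beta> inj tree q] L by (simp add: V_def k_def m_def)
    also have "\<dots> \<le> up * ((2 + \<beta>) * real (n + 2))"
    proof (rule order_trans[OF mult_left_mono mult_right_mono])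
      show "(2 + \<beta>) * real n + \<beta> \<le> (2 + \<beta>) * real (n + 2)" using \<beta> by (simp add: algebra_simps)
    qed (use upL q0[OF L(1)] \<beta> in auto)
    finally have *: "(real m + \<beta>) * sum q V \<le> up * ((2 + \<beta>) * real (n + 2))" .
    \<comment> \<open>The factor 4 combines the two leaf charges with the 2 in the denominator of
      \<open>w\<close>.\<close>
    have "(real m + \<beta>) * (sum q V * 4) = 4 * ((real m + \<beta>) * sum q V)" by simp
    also have "\<dots> \<le> 4 * (up * ((2 + \<beta>) * real (n + 2)))" using * by simp
    also have "\<dots> = (4 * (2 + \<beta>)) * (up * real (n + 2))" by simp
    also have "\<dots> \<le> (real m - 1) * (up * real (n + 2))"
      using large up0 by (intro mult_right_mono) (auto simp: m_def)
    finally have "sum q V * 2 \<le> up * real (n + 2) * (real m - 1) / (2 * (real m + \<beta>))"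
      using mb by (simp add: field_simps)
    from mult_right_mono[OF this less_imp_le[OF g]]
    show "sum q V * (2 * urn_kernel \<beta> m 1) - up * real (n + 2) * w \<le> 0"
      by (simp add: w_def mult_ac)
  qed
  finally show ?thesis
    by (simp add: right_diff_distrib sum_subtractf sum_distrib_right V_def)
qed

section \<open>The law of the chosen vertex\<close>

text \<open>The distributive law. With probability weights, this is the chance that \<open>l\<close>
  independent draws all fall into \<open>S\<close>.\<close>

lemma sum_prod_list_length:
  fixes W :: "'a \<Rightarrow> real"
  assumes "finite S"
  shows "(\<Sum>xs | set xs \<subseteq> S \<and> length xs = l. \<Prod>x\<leftarrow>xs. W x) = (\<Sum>x \<in> S. W x) ^ l"
proof (induction l)
  case 0
  have "{xs. set xs \<subseteq> S \<and> length xs = 0} = {[]}" by auto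
  then show ?case by simp
next
  case (Suc l)
  have inj: "inj_on (\<lambda>(xs, x). x # xs) A" for A :: "('a list \<times> 'a) set"
    by (auto simp: inj_on_def)
  have "(\<Sum>xs | set xs \<subseteq> S \<and> length xs = Suc l. \<Prod>x\<leftarrow>xs. W x) =
    (\<Sum>(xs, x) \<in> {xs. set xs \<subseteq> S \<and> length xs = l} \<times> S. (\<Prod>x\<leftarrow>xs. W x) * W x)"
    unfolding lists_length_Suc_eq sum.reindex[OF inj] by (intro sum.cong) auto
  also have "\<dots> = (\<Sum>x \<in> S. W x) ^ l * (\<Sum>x \<in> S. W x)"
    unfolding sum.cartesian_product[symmetric] Suc[symmetric] by (simp add: sum_product)
  finally show ?case by simp
qed

text \<open>The conditional probability of choosing \<open>x\<close> from \<open>l\<close> draws: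
  the weight of each sample is shared equally among its vertices of largest degree.\<close>

definition choice_weight :: "('v \<Rightarrow> real) \<Rightarrow> 'v set set \<Rightarrow> 'v set \<Rightarrow> nat \<Rightarrow> 'v \<Rightarrow> real" where
  "choice_weight W e V l x =
     (\<Sum>xs | set xs \<subseteq> V \<and> length xs = l \<and> x \<in> largest e xs. (\<Prod>z\<leftarrow>xs. W z) / real (card (largest e xs)))"

text \<open>Exchanging \<open>x\<close> and \<open>y\<close> throughout a sample preserves degrees
  and weights, hence maps the samples favouring \<open>x\<close> bijectively to those favouring
  \<open>y\<close>.\<close>

lemma choice_weight_eq:
  assumes V: "x \<in> V" "y \<in> V" and eq: "vdegree e x = vdegree e y" "W x = W y"
  shows "choice_weight W e V l x = choice_weight W e V l y"
proof -
  let ?t = "Transposition.transpose x y"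
  have deg: "vdegree e (?t z) = vdegree e z" and W: "W (?t z) = W z" for z
    using eq by (simp_all add: Transposition.transpose_def)
  have large: "largest e (map ?t xs) = ?t ` largest e xs" for xs
    using deg by (auto simp: largest_def)
  have card: "card (largest e (map ?t xs)) = card (largest e xs)" for xs
    unfolding large by (rule card_image) simp
  have V': "?t z \<in> V" if "z \<in> V" for z using that V by (auto simp: Transposition.transpose_def)
  show ?thesis
    unfolding choice_weight_def
  proof (rule sum.reindex_bij_witness[where i = "map ?t" and j = "map ?t"])
    show "map ?t (map ?t xs) = xs" "map ?t (map ?t xs) = xs" for xs
      by (auto simp: comp_def)
    show "(\<Prod>z\<leftarrow>map ?t xs. W z) / real (card (largest e (map ?t xs))) = (\<Prod>z\<leftarrow>xs. W z) / real (card (largest e xs))" for xs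
      by (simp add: card W comp_def)
    show "map ?t xs \<in> {xs. set xs \<subseteq> V \<and> length xs = l \<and> y \<in> largest e xs}"
      if "xs \<in> {xs. set xs \<subseteq> V \<and> length xs = l \<and> x \<in> largest e xs}" for xs
      using that V' unfolding mem_Collect_eq large by (auto intro: rev_image_eqI)
    show "map ?t xs \<in> {xs. set xs \<subseteq> V \<and> length xs = l \<and> x \<in> largest e xs}"
      if "xs \<in> {xs. set xs \<subseteq> V \<and> length xs = l \<and> y \<in> largest e xs}" for xs
      using that V' unfolding mem_Collect_eq large by (auto intro: rev_image_eqI)
  qed
qed

section \<open>Sigma-algebras of the past and conditional probabilities\<close>

lemma history_gen: "{E k -` A \<inter> space M | k A. 1 \<le> k \<and> k \<le> n} \<subseteq> Pow (space M)"
  by auto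

lemma space_history [simp]: "space (history M E n) = space M"
  unfolding history_def by (rule space_measure_of[OF history_gen])

lemma sets_history:
  "sets (history M E n) = sigma_sets (space M) {E k -` A \<inter> space M | k A. 1 \<le> k \<and> k \<le> n}"
  unfolding history_def by (rule sets_measure_of[OF history_gen])

lemma history_event:
  assumes "1 \<le> k" "k \<le> n" shows "{\<omega> \<in> space M. Q (E k \<omega>)} \<in> sets (history M E n)"
proof -
  have "E k -` {e. Q e} \<inter> space M \<in> sets (history M E n)"
    unfolding sets_history using assms
    by (intro sigma_sets.Basic CollectI exI[of _ k] exI[of _ "{e. Q e}"] conjI refl)
  moreover have "E k -` {e. Q e} \<inter> space M = {\<omega> \<in> space M. Q (E k \<omega>)}" by auto
  ultimately show ?thesis by simp
qed

lemma subalgebra_history: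
  assumes "\<And>k. 1 \<le> k \<Longrightarrow> E k \<in> measurable M (count_space UNIV)"
  shows "subalgebra M (history M E n)"
  unfolding subalgebra_def sets_history space_history
  using assms by (auto intro!: sets.sigma_sets_subset)

lemma adjoin_gen: "sets F \<union> {f -` A \<inter> space F | A. True} \<subseteq> Pow (space F)"
  using sets.sets_into_space[of _ F] by auto

lemma space_adjoin [simp]: "space (adjoin F f) = space F"
  unfolding adjoin_def by (rule space_measure_of[OF adjoin_gen])

lemma sets_adjoin:
  "sets (adjoin F f) = sigma_sets (space F) (sets F \<union> {f -` A \<inter> space F | A. True})"
  unfolding adjoin_def by (rule sets_measure_of[OF adjoin_gen])

lemma adjoin_sets: "G \<in> sets F \<Longrightarrow> G \<in> sets (adjoin F f)"
  by (auto simp: sets_adjoin)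

lemma adjoin_event: "{\<omega> \<in> space F. f \<omega> = x} \<in> sets (adjoin F f)"
proof -
  have "{\<omega> \<in> space F. f \<omega> = x} = f -` {x} \<inter> space F" by auto
  then show ?thesis unfolding sets_adjoin by (intro sigma_sets.Basic) auto
qed

lemma subalgebra_adjoin:
  assumes "subalgebra M F" "f \<in> measurable M (count_space UNIV)"
  shows "subalgebra M (adjoin F f)"
proof -
  have "f -` A \<inter> space F \<in> sets M" for A
    using assms measurable_sets[OF assms(2), of A] by (simp add: subalgebra_def)
  then show ?thesis
    using assms unfolding subalgebra_def sets_adjoin space_adjoin
    by (auto intro!: sets.sigma_sets_subset[of _ M, simplified])
qed

context prob_space
begin

text \<open>Integrating the conditional probability over \<open>G\<close> turns the almost sure laws
  of the model into product formulas for events; later arguments use these formulas only.\<close>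

lemma cprob_constant:
  assumes F: "subalgebra M F" and G: "G \<in> sets F" and B: "{\<omega> \<in> space M. Q \<omega>} \<in> events"
    and AE: "AE \<omega> in M. \<omega> \<in> G \<longrightarrow> cprob M F Q \<omega> = c"
  shows "prob (G \<inter> {\<omega> \<in> space M. Q \<omega>}) = c * prob G"
proof -
  interpret finite_measure_subalgebra M F
    using F by unfold_locales
  define B where "B = {\<omega> \<in> space M. Q \<omega>}"
  have [measurable]: "B \<in> events" "G \<in> events"
    using B G F by (auto simp: B_def subalgebra_def)
  have [measurable]: "cprob M F Q \<in> borel_measurable M"
    unfolding cprob_def by simp
  have "prob (G \<inter> B) = (\<integral>\<omega>\<in>G. indicator B \<omega> \<partial>M)"
    by (simp add: set_lebesgue_integral_def indicator_inter_arith[symmetric])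
  also have "\<dots> = (\<integral>\<omega>\<in>G. cprob M F Q \<omega> \<partial>M)"
    unfolding cprob_def B_def[symmetric] by (rule real_cond_exp_intA) (use G in \<open>auto simp: integrable_indicator_iff emeasure_eq_measure\<close>)
  also have "\<dots> = (\<integral>\<omega>\<in>G. c \<partial>M)"
    unfolding set_lebesgue_integral_def using AE
    by (intro integral_cong_AE) (auto simp: indicator_def)
  also have "\<dots> = c * prob G"
    by (simp add: set_lebesgue_integral_def)
  finally show ?thesis by (simp add: B_def)
qed

end

section \<open>Measurability of the tree process\<close>

context max_choice_mori_tree
begin

lemma Y_vertices: "n \<ge> 1 \<Longrightarrow> \<omega> \<in> space M \<Longrightarrow> Y n \<omega> \<in> vertices v n"
  using Y_largest[of n \<omega>] X_vertices[of n \<omega>] by (auto simp: largest_def)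

lemma recursive_tree_E: "n \<ge> 1 \<Longrightarrow> \<omega> \<in> space M \<Longrightarrow> recursive_tree v n (E n \<omega>)"
proof (induction n rule: nat_induct_at_least)
  case base
  have ne: "v 1 \<noteq> v 2" using inj_onD[OF v_distinct, of 1 2] by auto
  have V: "vertices v 1 = {v 1, v 2}"
    by (simp add: vertices_def atLeastAtMostSuc_conv numeral_2_eq_2 insert_commute)
  have "{a \<in> {{v 1, v 2}}. x \<in> a} = {{v 1, v 2}}" if "x \<in> {v 1, v 2}" for x using that by auto
  then have "vdegree {{v 1, v 2}} x = 1" if "x \<in> {v 1, v 2}" for x
    using that by (simp add: vdegree_def)
  then have "recursive_tree v 1 {{v 1, v 2}}"
    unfolding recursive_tree_def V using ne by simp
  then show ?case unfolding E_1[OF base] .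
next
  case (Suc n)
  then show ?case
    using recursive_tree_Suc[OF v_distinct _ Y_vertices] E_Suc[of n \<omega>] by simp
qed

lemma E_Pow: "n \<ge> 1 \<Longrightarrow> \<omega> \<in> space M \<Longrightarrow> E n \<omega> \<in> Pow (Pow (vertices v n))"
  using recursive_tree_E by (auto simp: recursive_tree_def)

text \<open>There are finitely many possible pairs of current tree and chosen vertex, so each
  preimage is a finite union of events. This avoids product measurability over the possibly
  uncountable type of vertices.\<close>

lemma E_measurable:
  assumes "n \<ge> 1"
  shows "E n \<in> measurable M (count_space UNIV)"
  using assms
proof (induction n rule: nat_induct_at_least)
  case base
  show ?case by (subst measurable_cong[OF E_1]) simp_all
next
  case (Suc n)
  show ?case
  proof (rule measurableI)
    fix A :: "'v set set set"
    let ?I = "{(e, y) \<in> Pow (Pow (vertices v n)) \<times> vertices v n. insert {v (n + 2), y} e \<in> A}"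
    have "E (Suc n) -` A \<inter> space M =
      (\<Union>p \<in> ?I. (E n -` {fst p} \<inter> space M) \<inter> (Y n -` {snd p} \<inter> space M))"
    proof (intro set_eqI iffI)
      fix \<omega> assume \<omega>: "\<omega> \<in> E (Suc n) -` A \<inter> space M"
      then have "(E n \<omega>, Y n \<omega>) \<in> ?I"
        using E_Suc[OF Suc(1), of \<omega>] E_Pow[OF Suc(1), of \<omega>] Y_vertices[OF Suc(1), of \<omega>] by simp
      moreover have "\<omega> \<in> (E n -` {fst (E n \<omega>, Y n \<omega>)} \<inter> space M) \<inter> (Y n -` {snd (E n \<omega>, Y n \<omega>)} \<inter> space M)"
        using \<omega> by simp
      ultimately show "\<omega> \<in> (\<Union>p \<in> ?I. (E n -` {fst p} \<inter> space M) \<inter> (Y n -` {snd p} \<inter> space M))"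
        by (rule UN_I)
    next
      fix \<omega> assume "\<omega> \<in> (\<Union>p \<in> ?I. (E n -` {fst p} \<inter> space M) \<inter> (Y n -` {snd p} \<inter> space M))"
      then have "\<omega> \<in> space M" "insert {v (n + 2), Y n \<omega>} (E n \<omega>) \<in> A" by auto
      then show "\<omega> \<in> E (Suc n) -` A \<inter> space M"
        using E_Suc[OF Suc(1), of \<omega>] by simp
    qed
    also have "\<dots> \<in> events"
    proof (rule sets.finite_UN)
      show "finite ?I"
        by (rule finite_subset[of _ "Pow (Pow (vertices v n)) \<times> vertices v n"]) auto
    qed (intro sets.Int measurable_sets[OF Suc(2)] measurable_sets[OF Y_measurable[OF Suc(1)]]; simp)
    finally show "E (Suc n) -` A \<inter> space M \<in> events" .
  qed simp
qed

lemma d_measurable: "n \<ge> 1 \<Longrightarrow> d n \<in> measurable M (count_space UNIV)"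
  using d_indep by (auto simp: indep_vars_def)

lemma subalgebra_E: "subalgebra M (history M E n)"
  using E_measurable by (rule subalgebra_history)

lemma history_events: "H \<in> sets (history M E n) \<Longrightarrow> H \<in> events"
  using subalgebra_E by (auto simp: subalgebra_def)

lemma count_event:
  assumes "f \<in> measurable M (count_space UNIV)" shows "{\<omega> \<in> space M. Q (f \<omega>)} \<in> events"
proof -
  have "{\<omega> \<in> space M. Q (f \<omega>)} = f -` {x. Q x} \<inter> space M" by auto
  then show ?thesis using measurable_sets[OF assms, of "{x. Q x}"] by simp
qed

section \<open>Law of the choice on a past event that fixes the tree, with the sample size fixed as
  well\<close>

context
  fixes n l :: nat and e :: "'v set set" and H G :: "'w set"
  assumes n: "n \<ge> 1" and H: "H \<in> sets (history M E n)" and He: "H \<subseteq> {\<omega> \<in> space M. E n \<omega> = e}"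
  defines "G \<equiv> H \<inter> {\<omega> \<in> space M. d n \<omega> = l}"
begin

lemma G_events: "G \<in> events"
  unfolding G_def using history_events[OF H] count_event[OF d_measurable[OF n], of "\<lambda>x. x = l"] by blast

lemma X_event: "{\<omega> \<in> space M. Q (X n \<omega>)} \<in> events"
  by (rule count_event[OF X_measurable[OF n]])

lemma Y_event: "{\<omega> \<in> space M. Q (Y n \<omega>)} \<in> events"
  by (rule count_event[OF Y_measurable[OF n]])

text \<open>On \<open>G\<close> both the tree and the sample size are constant, and so is the
  conditional probability from \<open>X_law\<close>.\<close>

lemma prob_X:
  assumes "set xs \<subseteq> vertices v n" "length xs = l"
  shows "prob (G \<inter> {\<omega> \<in> space M. X n \<omega> = xs}) = (\<Prod>x\<leftarrow>xs. vertex_prob \<beta> n e x) * prob G"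
proof (rule cprob_constant[where F = "adjoin (history M E n) (d n)"])
  show "G \<in> sets (adjoin (history M E n) (d n))"
    using sets.Int[OF adjoin_sets[OF H] adjoin_event[of "history M E n" "d n" l]] by (simp add: G_def)
  show "AE \<omega> in M. \<omega> \<in> G \<longrightarrow> cprob M (adjoin (history M E n) (d n)) (\<lambda>\<omega>. X n \<omega> = xs) \<omega> =
      (\<Prod>x\<leftarrow>xs. vertex_prob \<beta> n e x)"
    using X_law[OF n assms(1)]
  proof eventually_elim
    case (elim \<omega>)
    show ?case
    proof
      assume "\<omega> \<in> G"
      then have "d n \<omega> = l" "E n \<omega> = e" using He by (auto simp: G_def)
      with elim assms(2) show "cprob M (adjoin (history M E n) (d n)) (\<lambda>\<omega>. X n \<omega> = xs) \<omega> =
          (\<Prod>x\<leftarrow>xs. vertex_prob \<beta> n e x)" by simp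
    qed
  qed
qed (fact subalgebra_adjoin[OF subalgebra_E d_measurable[OF n]] X_event)+

lemma prob_X_Y:
  assumes xs: "set xs \<subseteq> vertices v n" "length xs = l" and y: "y \<in> largest e xs"
  shows "prob (G \<inter> {\<omega> \<in> space M. X n \<omega> = xs} \<inter> {\<omega> \<in> space M. Y n \<omega> = y}) =
     prob G * ((\<Prod>x\<leftarrow>xs. vertex_prob \<beta> n e x) / real (card (largest e xs)))"
proof -
  let ?F = "adjoin (history M E n) (d n)"
  have "prob (G \<inter> {\<omega> \<in> space M. X n \<omega> = xs} \<inter> {\<omega> \<in> space M. Y n \<omega> = y}) =
     1 / real (card (largest e xs)) * prob (G \<inter> {\<omega> \<in> space M. X n \<omega> = xs})"
  proof (rule cprob_constant[where F = "adjoin ?F (X n)"])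
    have "G \<in> sets (adjoin ?F (X n))"
      using sets.Int[OF adjoin_sets[OF adjoin_sets[OF H]]
          adjoin_sets[OF adjoin_event[of "history M E n" "d n" l]]]
      by (simp add: G_def)
    then show "G \<inter> {\<omega> \<in> space M. X n \<omega> = xs} \<in> sets (adjoin ?F (X n))"
      using adjoin_event[of ?F "X n" xs] by (simp add: sets.Int)
    have "y \<in> vertices v n" using xs y by (auto simp: largest_def)
    from Y_law[OF n this] show "AE \<omega> in M. \<omega> \<in> G \<inter> {\<omega> \<in> space M. X n \<omega> = xs} \<longrightarrow>
        cprob M (adjoin ?F (X n)) (\<lambda>\<omega>. Y n \<omega> = y) \<omega> = 1 / real (card (largest e xs))"
    proof eventually_elim
      case (elim \<omega>)
      show ?case
      proof
        assume "\<omega> \<in> G \<inter> {\<omega> \<in> space M. X n \<omega> = xs}"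
        then have "X n \<omega> = xs" "E n \<omega> = e" using He by (auto simp: G_def)
        with elim y show "cprob M (adjoin ?F (X n)) (\<lambda>\<omega>. Y n \<omega> = y) \<omega> = 1 / real (card (largest e xs))"
          by simp
      qed
    qed
  qed (fact subalgebra_adjoin[OF subalgebra_adjoin[OF subalgebra_E d_measurable[OF n]] X_measurable[OF n]]
        Y_event)+
  then show ?thesis using prob_X[OF xs] by simp
qed

lemma finite_samples: "finite {xs. set xs \<subseteq> vertices v n \<and> length xs = l}"
  by (rule finite_lists_length_eq) simp

text \<open>Serves to transfer exchangeability to the process: vertices of equal degree are equally
  likely to be chosen.\<close>

lemma prob_Y_choice_weight:
  "prob (G \<inter> {\<omega> \<in> space M. Y n \<omega> = y}) =
     prob G * choice_weight (vertex_prob \<beta> n e) e (vertices v n) l y"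
proof -
  let ?L = "{xs. set xs \<subseteq> vertices v n \<and> length xs = l \<and> y \<in> largest e xs}"
  have fin: "finite ?L" by (rule finite_subset[OF _ finite_samples]) auto
  have "G \<inter> {\<omega> \<in> space M. Y n \<omega> = y} =
     (\<Union>xs \<in> ?L. G \<inter> {\<omega> \<in> space M. X n \<omega> = xs} \<inter> {\<omega> \<in> space M. Y n \<omega> = y})" (is "?A = _")
  proof -
    have "\<omega> \<in> space M \<and> X n \<omega> \<in> ?L \<and> Y n \<omega> = y" if "\<omega> \<in> ?A" for \<omega>
      using that He X_vertices[OF n, of \<omega>] X_length[OF n, of \<omega>] Y_largest[OF n, of \<omega>] by (auto simp: G_def)
    then show ?thesis by blast
  qed
  also have "prob \<dots> = (\<Sum>xs \<in> ?L. prob (G \<inter> {\<omega> \<in> space M. X n \<omega> = xs} \<inter> {\<omega> \<in> space M. Y n \<omega> = y}))"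
    using fin G_events X_event[of "\<lambda>x. x = _"] Y_event[of "\<lambda>x. x = y"]
    by (intro finite_measure_finite_Union) (auto simp: disjoint_family_on_def intro!: sets.Int)
  also have "\<dots> = (\<Sum>xs \<in> ?L. prob G * ((\<Prod>x\<leftarrow>xs. vertex_prob \<beta> n e x) / real (card (largest e xs))))"
    by (intro sum.cong) (auto simp: prob_X_Y)
  finally show ?thesis by (simp add: choice_weight_def sum_distrib_left)
qed

lemma prob_X_subset:
  assumes "S \<subseteq> vertices v n"
  shows "prob (G \<inter> {\<omega> \<in> space M. set (X n \<omega>) \<subseteq> S}) = prob G * (\<Sum>x \<in> S. vertex_prob \<beta> n e x) ^ l"
proof -
  let ?L = "{xs. set xs \<subseteq> S \<and> length xs = l}"
  have fin: "finite ?L" by (rule finite_subset[OF _ finite_samples]) (use assms in auto)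
  have "G \<inter> {\<omega> \<in> space M. set (X n \<omega>) \<subseteq> S} = (\<Union>xs \<in> ?L. G \<inter> {\<omega> \<in> space M. X n \<omega> = xs})"
    using X_length[OF n] by (auto simp: G_def)
  also have "prob \<dots> = (\<Sum>xs \<in> ?L. prob (G \<inter> {\<omega> \<in> space M. X n \<omega> = xs}))"
    using fin G_events X_event[of "\<lambda>x. x = _"]
    by (intro finite_measure_finite_Union) (auto simp: disjoint_family_on_def intro!: sets.Int)
  also have "\<dots> = (\<Sum>xs \<in> ?L. (\<Prod>x\<leftarrow>xs. vertex_prob \<beta> n e x) * prob G)"
    using assms by (intro sum.cong) (auto simp: prob_X)
  finally show ?thesis
    unfolding sum_distrib_right[symmetric]
    using sum_prod_list_length[of S "vertex_prob \<beta> n e" l] finite_subset[OF assms] by simp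
qed

text \<open>
  Exchangeability of vertices of equal degree reduces the law of the choice to that of its degree,
  and the chosen degree lies in a down-set iff all sampled degrees do. The last factor is the
  slope of \<open>t \<mapsto> t ^ l\<close> between the masses of \<open>{z. deg z < deg y}\<close> and \<open>{z. deg z \<le> deg y}\<close>.
\<close>

lemma prob_Y:
  assumes y: "y \<in> vertices v n" and l: "l \<ge> 1"
  defines "mass \<equiv> \<lambda>P. \<Sum>x | x \<in> vertices v n \<and> P (vdegree e x). vertex_prob \<beta> n e x"
  shows "prob (G \<inter> {\<omega> \<in> space M. Y n \<omega> = y}) = prob G * vertex_prob \<beta> n e y *
    (\<Sum>i<l. mass (\<lambda>k. k < vdegree e y) ^ (l - Suc i) * mass (\<lambda>k. k \<le> vdegree e y) ^ i)"
proof -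
  let ?k = "vdegree e y"
  let ?W = "vertex_prob \<beta> n e"
  let ?C = "{x \<in> vertices v n. vdegree e x = ?k}"
  have down: "prob (G \<inter> {\<omega> \<in> space M. P (vdegree e (Y n \<omega>))}) = prob G * mass P ^ l"
    if P: "\<And>i j. i \<le> j \<Longrightarrow> P j \<Longrightarrow> P i" for P
  proof -
    have "P (vdegree e (Y n \<omega>)) \<longleftrightarrow> set (X n \<omega>) \<subseteq> {x \<in> vertices v n. P (vdegree e x)}" if "\<omega> \<in> G" for \<omega>
    proof -
      have \<omega>: "\<omega> \<in> space M" "E n \<omega> = e" using that He by (auto simp: G_def)
      show ?thesis
        using Y_largest[OF n \<omega>(1)] X_vertices[OF n \<omega>(1)] P \<omega>(2) by (auto simp: largest_def)
    qed
    then have "G \<inter> {\<omega> \<in> space M. P (vdegree e (Y n \<omega>))} =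
      G \<inter> {\<omega> \<in> space M. set (X n \<omega>) \<subseteq> {x \<in> vertices v n. P (vdegree e x)}}" by auto
    then show ?thesis using prob_X_subset by (simp add: mass_def)
  qed
  \<comment> \<open>All members of the degree class are equally likely, so the probability of the
    whole class determines that of \<open>y\<close>.\<close>
  have "real (card ?C) * prob (G \<inter> {\<omega> \<in> space M. Y n \<omega> = y}) =
      (\<Sum>x \<in> ?C. prob (G \<inter> {\<omega> \<in> space M. Y n \<omega> = x}))"
  proof -
    have "prob (G \<inter> {\<omega> \<in> space M. Y n \<omega> = x}) = prob (G \<inter> {\<omega> \<in> space M. Y n \<omega> = y})" if "x \<in> ?C" for x
      using choice_weight_eq[of x "vertices v n" y e ?W l] that y
      by (simp add: prob_Y_choice_weight vertex_prob_def)
    then show ?thesis by simp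
  qed
  also have "\<dots> = prob (\<Union>x \<in> ?C. G \<inter> {\<omega> \<in> space M. Y n \<omega> = x})"
    using G_events Y_event[of "\<lambda>x. x = _"]
    by (intro finite_measure_finite_Union[symmetric]) (auto simp: disjoint_family_on_def intro!: sets.Int)
  \<comment> \<open>Choosing degree exactly \<open>?k\<close> is the difference of two down-set
    events, whose probabilities are \<open>l\<close>-th powers of masses times
    \<open>prob G\<close>.\<close>
  also have "(\<Union>x \<in> ?C. G \<inter> {\<omega> \<in> space M. Y n \<omega> = x}) =
     (G \<inter> {\<omega> \<in> space M. vdegree e (Y n \<omega>) \<le> ?k}) - (G \<inter> {\<omega> \<in> space M. vdegree e (Y n \<omega>) < ?k})"
    using Y_vertices[OF n] by auto
  also have "prob \<dots> = prob (G \<inter> {\<omega> \<in> space M. vdegree e (Y n \<omega>) \<le> ?k}) - prob (G \<inter> {\<omega> \<in> space M. vdegree e (Y n \<omega>) < ?k})"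
    using G_events Y_event by (intro finite_measure_Diff) auto
  also have "\<dots> = prob G * (mass (\<lambda>k. k \<le> ?k) ^ l - mass (\<lambda>k. k < ?k) ^ l)"
    by (subst (1 2) down) (auto simp: algebra_simps)
  also have "\<dots> = prob G * ((mass (\<lambda>k. k \<le> ?k) - mass (\<lambda>k. k < ?k)) *
      (\<Sum>i<l. mass (\<lambda>k. k < ?k) ^ (l - Suc i) * mass (\<lambda>k. k \<le> ?k) ^ i))"
    by (simp only: power_diff_sumr2)
  also have "mass (\<lambda>k. k \<le> ?k) - mass (\<lambda>k. k < ?k) = (\<Sum>x \<in> ?C. ?W x)"
  proof -
    have "{x \<in> vertices v n. vdegree e x \<le> ?k} = {x \<in> vertices v n. vdegree e x < ?k} \<union> ?C" by auto
    then have "mass (\<lambda>k. k \<le> ?k) = mass (\<lambda>k. k < ?k) + (\<Sum>x \<in> ?C. ?W x)"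
      unfolding mass_def by (simp only:) (rule sum.union_disjoint; auto)
    then show ?thesis by simp
  qed
  also have "(\<Sum>x \<in> ?C. ?W x) = real (card ?C) * ?W y"
    by (simp add: vertex_prob_def)
  finally have "real (card ?C) * prob (G \<inter> {\<omega> \<in> space M. Y n \<omega> = y}) = real (card ?C) *
    (prob G * ?W y * (\<Sum>i<l. mass (\<lambda>k. k < ?k) ^ (l - Suc i) * mass (\<lambda>k. k \<le> ?k) ^ i))"
    by (simp add: mult_ac)
  moreover have "real (card ?C) \<noteq> 0"
  proof -
    have "card ?C \<noteq> 0" using y by (subst card_0_eq) auto
    then show ?thesis by linarith
  qed
  ultimately show ?thesis by (rule mult_left_cancel[THEN iffD1, rotated])
qed

end

text \<open>For a fixed sample size, \<open>prob_Y\<close> gives the weight of the vertex times a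
  slope that increases with its degree. Summing over all sample sizes keeps the inequality.\<close>

lemma degree_biased_choice:
  assumes \<beta>: "\<beta> > -1" and n: "n \<ge> 1" and H: "H \<in> sets (history M E n)"
    and He: "H \<subseteq> {\<omega> \<in> space M. E n \<omega> = e}" and e: "recursive_tree v n e"
  shows "degree_biased \<beta> v n e (\<lambda>y. prob (H \<inter> {\<omega> \<in> space M. Y n \<omega> = y}))"
proof -
  let ?W = "vertex_prob \<beta> n e"
  define Z where "Z = (2 + \<beta>) * real n + \<beta>"
  \<comment> \<open>Since \<open>n \<ge> 1\<close>, \<open>Z\<close> is at least
    \<open>2 + 2 * \<beta>\<close>.\<close>
  have Z: "Z > 0"
  proof -
    have "2 + \<beta> \<le> (2 + \<beta>) * real n"
      using mult_left_mono[of 1 "real n" "2 + \<beta>"] n \<beta> by simp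
    then have "2 + \<beta> + \<beta> \<le> Z" unfolding Z_def by (rule add_right_mono)
    then show ?thesis using \<beta> by linarith
  qed
  have W: "?W z > 0" if "z \<in> vertices v n" for z
  proof -
    have "1 \<le> real (vdegree e z)" using e that by (auto simp: recursive_tree_def)
    then have "real (vdegree e z) + \<beta> > 0" using \<beta> by linarith
    then show ?thesis using Z by (simp add: vertex_prob_def Z_def)
  qed
  define G where "G = (\<lambda>l. H \<inter> {\<omega> \<in> space M. d n \<omega> = l})"
  have Gev: "G l \<in> events" for l unfolding G_def using G_events[OF n H He] by simp
  have sums: "(\<lambda>l. prob (G l \<inter> {\<omega> \<in> space M. Y n \<omega> = z})) sums prob (H \<inter> {\<omega> \<in> space M. Y n \<omega> = z})" for z
  proof -
    have "(\<lambda>l. prob (G l \<inter> {\<omega> \<in> space M. Y n \<omega> = z})) sums prob (\<Union>l. G l \<inter> {\<omega> \<in> space M. Y n \<omega> = z})"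
      using Gev count_event[OF Y_measurable[OF n], of "\<lambda>x. x = z"]
      by (intro finite_measure_UNION) (auto simp: disjoint_family_on_def G_def)
    moreover have "(\<Union>l. G l \<inter> {\<omega> \<in> space M. Y n \<omega> = z}) = H \<inter> {\<omega> \<in> space M. Y n \<omega> = z}"
      by (auto simp: G_def)
    ultimately show ?thesis by simp
  qed
  have le: "prob (H \<inter> {\<omega> \<in> space M. Y n \<omega> = y}) * (real (vdegree e x) + \<beta>) \<le>
        prob (H \<inter> {\<omega> \<in> space M. Y n \<omega> = x}) * (real (vdegree e y) + \<beta>)"
    if x: "x \<in> vertices v n" and y: "y \<in> vertices v n" and deg: "vdegree e y \<le> vdegree e x" for x y
  proof -
    have "prob (G l \<inter> {\<omega> \<in> space M. Y n \<omega> = y}) * ?W x \<le> prob (G l \<inter> {\<omega> \<in> space M. Y n \<omega> = x}) * ?W y" for l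
    proof (cases "l \<ge> 1")
      \<comment> \<open>An empty sample would offer no choice; \<open>d_pos\<close> excludes
        it.\<close>
      case False
      then have "G l = {}" using d_pos[OF n] by (auto simp: G_def)
      then show ?thesis by simp
    next
      case True
      define mass where "mass = (\<lambda>P. \<Sum>x | x \<in> vertices v n \<and> P (vdegree e x). ?W x)"
      define T where "T = (\<lambda>z. \<Sum>i<l. mass (\<lambda>k. k < vdegree e z) ^ (l - Suc i) * mass (\<lambda>k. k \<le> vdegree e z) ^ i)"
      have T: "prob (G l \<inter> {\<omega> \<in> space M. Y n \<omega> = z}) = prob (G l) * ?W z * T z" if "z \<in> vertices v n" for z
        unfolding T_def mass_def G_def by (rule prob_Y[OF n H He that True])
      have mono: "mass P \<le> mass Q" if "\<And>k. P k \<Longrightarrow> Q k" for P Q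
        unfolding mass_def using that W by (intro sum_mono2) (auto simp: less_imp_le)
      have nn: "mass P \<ge> 0" for P unfolding mass_def using W by (intro sum_nonneg) (auto simp: less_imp_le)
      have "T y \<le> T x"
        unfolding T_def using deg by (intro sum_mono mult_mono power_mono mono nn zero_le_power) auto
      then have "(prob (G l) * ?W x * ?W y) * T y \<le> (prob (G l) * ?W x * ?W y) * T x"
        using W[OF x] W[OF y] by (intro mult_left_mono) auto
      then show ?thesis using T[OF x] T[OF y] by (simp add: mult_ac)
    qed
    then have "prob (H \<inter> {\<omega> \<in> space M. Y n \<omega> = y}) * ?W x \<le> prob (H \<inter> {\<omega> \<in> space M. Y n \<omega> = x}) * ?W y"
      by (rule sums_le[OF _ sums_mult2[OF sums] sums_mult2[OF sums]])
    then show ?thesis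
      using Z by (simp add: vertex_prob_def Z_def[symmetric] divide_simps)
  qed
  then show ?thesis by (auto simp: degree_biased_def)
qed

end

section \<open>Almost sure behaviour\<close>

context max_choice_mori_tree
begin

definition top_degree :: "nat \<Rightarrow> 'w \<Rightarrow> nat" where
  "top_degree n \<omega> = max_degree (vertices v n) (E n \<omega>)"

definition leads :: "nat \<Rightarrow> 'w \<Rightarrow> nat \<Rightarrow> bool" where
  "leads n \<omega> i \<longleftrightarrow> i \<in> {1..n + 1} \<and> vdegree (E n \<omega>) (v i) = top_degree n \<omega> \<and>
     (\<forall>j \<in> {1..n + 1} - {i}. vdegree (E n \<omega>) (v j) < top_degree n \<omega>)"

section \<open>Expectations as finite sums over trees and choices\<close>

lemma E_event: "n \<ge> 1 \<Longrightarrow> {\<omega> \<in> space M. Q (E n \<omega>)} \<in> events"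
  by (rule count_event[OF E_measurable])

lemma chosen_event: "n \<ge> 1 \<Longrightarrow> {\<omega> \<in> space M. Y n \<omega> = y} \<in> events"
  by (rule count_event[OF Y_measurable])

lemma integrable_event: "A \<in> events \<Longrightarrow> integrable M (indicator A :: 'w \<Rightarrow> real)"
  by (simp add: integrable_indicator_iff emeasure_eq_measure sets.Int)

text \<open>\<open>E n\<close> takes finitely many values, so every function of it is integrable.
  The event \<open>H\<close> takes the place of conditioning on the past.\<close>

lemma expectation_E:
  fixes \<psi> :: "'v set set \<Rightarrow> real"
  assumes n: "n \<ge> 1" and H: "H \<in> events"
  shows "integrable M (\<lambda>\<omega>. indicator H \<omega> * \<psi> (E n \<omega>))"
    and "expectation (\<lambda>\<omega>. indicator H \<omega> * \<psi> (E n \<omega>)) =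
      (\<Sum>e \<in> Pow (Pow (vertices v n)). \<psi> e * prob (H \<inter> {\<omega> \<in> space M. E n \<omega> = e}))"
proof -
  have eq: "indicator H \<omega> * \<psi> (E n \<omega>) =
      (\<Sum>e \<in> Pow (Pow (vertices v n)). \<psi> e * indicator (H \<inter> {\<omega> \<in> space M. E n \<omega> = e}) \<omega>)"
    if \<omega>: "\<omega> \<in> space M" for \<omega>
  proof -
    have "(\<Sum>e \<in> Pow (Pow (vertices v n)). \<psi> e * indicator (H \<inter> {\<omega> \<in> space M. E n \<omega> = e}) \<omega>) =
      (\<Sum>e \<in> Pow (Pow (vertices v n)). if e = E n \<omega> then \<psi> e * indicator H \<omega> else 0)"
      using \<omega> by (intro sum.cong) (auto simp: indicator_def)
    also have "\<dots> = \<psi> (E n \<omega>) * indicator H \<omega>"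
      using E_Pow[OF n \<omega>] by simp
    finally show ?thesis by simp
  qed
  have H': "H \<inter> {\<omega> \<in> space M. E n \<omega> = e} \<in> events" for e
    by (rule sets.Int[OF H E_event[OF n]])
  then have int: "integrable M (\<lambda>\<omega>. \<psi> e * indicator (H \<inter> {\<omega> \<in> space M. E n \<omega> = e}) \<omega>)" for e
    by (intro integrable_mult_right integrable_event)
  show "integrable M (\<lambda>\<omega>. indicator H \<omega> * \<psi> (E n \<omega>))"
    by (subst Bochner_Integration.integrable_cong[OF refl eq])
      (assumption | intro Bochner_Integration.integrable_sum int)+
  have "expectation (\<lambda>\<omega>. indicator H \<omega> * \<psi> (E n \<omega>)) = expectation (\<lambda>\<omega>.
      \<Sum>e \<in> Pow (Pow (vertices v n)). \<psi> e * indicator (H \<inter> {\<omega> \<in> space M. E n \<omega> = e}) \<omega>)"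
    by (intro Bochner_Integration.integral_cong refl eq)
  also have "\<dots> = (\<Sum>e \<in> Pow (Pow (vertices v n)).
      expectation (\<lambda>\<omega>. \<psi> e * indicator (H \<inter> {\<omega> \<in> space M. E n \<omega> = e}) \<omega>))"
    by (intro Bochner_Integration.integral_sum int)
  also have "\<dots> = (\<Sum>e \<in> Pow (Pow (vertices v n)). \<psi> e * prob (H \<inter> {\<omega> \<in> space M. E n \<omega> = e}))"
    by (simp only: Bochner_Integration.integral_mult_right_zero Bochner_Integration.integral_indicator
        Int_absorb2[OF sets.sets_into_space[OF H']])
  finally show "expectation (\<lambda>\<omega>. indicator H \<omega> * \<psi> (E n \<omega>)) =
      (\<Sum>e \<in> Pow (Pow (vertices v n)). \<psi> e * prob (H \<inter> {\<omega> \<in> space M. E n \<omega> = e}))" .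
qed

lemma prob_split_Y:
  assumes n: "n \<ge> 1" and H: "H \<in> events"
  shows "prob H = (\<Sum>y \<in> vertices v n. prob (H \<inter> {\<omega> \<in> space M. Y n \<omega> = y}))"
proof -
  have "H = (\<Union>y \<in> vertices v n. H \<inter> {\<omega> \<in> space M. Y n \<omega> = y})"
    using Y_vertices[OF n] sets.sets_into_space[OF H] by auto
  also have "prob \<dots> = (\<Sum>y \<in> vertices v n. prob (H \<inter> {\<omega> \<in> space M. Y n \<omega> = y}))"
    using H chosen_event[OF n]
    by (intro finite_measure_finite_Union) (auto simp: disjoint_family_on_def intro!: sets.Int)
  finally show ?thesis .
qed

lemma prob_E_Suc:
  assumes n: "n \<ge> 1" and H: "H \<in> events"
  shows "prob (H \<inter> {\<omega> \<in> space M. E (Suc n) \<omega> = e'}) =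
    (\<Sum>e \<in> Pow (Pow (vertices v n)). \<Sum>y \<in> vertices v n.
       if insert {v (n + 2), y} e = e' then prob (H \<inter> {\<omega> \<in> space M. E n \<omega> = e} \<inter> {\<omega> \<in> space M. Y n \<omega> = y}) else 0)"
proof -
  let ?P = "Pow (Pow (vertices v n)) \<times> vertices v n"
  let ?I = "{p \<in> ?P. insert {v (n + 2), snd p} (fst p) = e'}"
  let ?A = "\<lambda>p. H \<inter> {\<omega> \<in> space M. E n \<omega> = fst p} \<inter> {\<omega> \<in> space M. Y n \<omega> = snd p}"
  have "H \<inter> {\<omega> \<in> space M. E (Suc n) \<omega> = e'} = (\<Union>p \<in> ?I. ?A p)"
  proof (intro set_eqI iffI)
    fix \<omega> assume \<omega>: "\<omega> \<in> H \<inter> {\<omega> \<in> space M. E (Suc n) \<omega> = e'}"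
    then have "(E n \<omega>, Y n \<omega>) \<in> ?I"
      using E_Suc[OF n, of \<omega>] E_Pow[OF n, of \<omega>] Y_vertices[OF n, of \<omega>] by simp
    moreover have "\<omega> \<in> ?A (E n \<omega>, Y n \<omega>)" using \<omega> by simp
    ultimately show "\<omega> \<in> (\<Union>p \<in> ?I. ?A p)" by (rule UN_I)
  next
    fix \<omega> assume "\<omega> \<in> (\<Union>p \<in> ?I. ?A p)"
    then have "\<omega> \<in> H" "\<omega> \<in> space M" "insert {v (n + 2), Y n \<omega>} (E n \<omega>) = e'" by auto
    then show "\<omega> \<in> H \<inter> {\<omega> \<in> space M. E (Suc n) \<omega> = e'}"
      using E_Suc[OF n, of \<omega>] by simp
  qed
  also have "prob (\<Union>p \<in> ?I. ?A p) = (\<Sum>p \<in> ?I. prob (?A p))"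
  proof (rule finite_measure_finite_Union)
    show "finite ?I" by (rule finite_subset[of _ ?P]) auto
    show "?A ` ?I \<subseteq> events"
      using H E_event[OF n] chosen_event[OF n] by (intro image_subsetI sets.Int)
    show "disjoint_family_on ?A ?I"
      by (auto simp: disjoint_family_on_def)
  qed
  also have "\<dots> = (\<Sum>p \<in> ?P. if insert {v (n + 2), snd p} (fst p) = e' then prob (?A p) else 0)"
    by (rule sum.inter_filter) simp
  finally show ?thesis
    by (simp add: sum.cartesian_product case_prod_beta)
qed

text \<open>Grouping by the previous tree and the chosen vertex produces the weighted sums over
  choices that \<open>potential_step\<close> bounds.\<close>

lemma expectation_E_Suc:
  fixes \<psi> :: "'v set set \<Rightarrow> real"
  assumes n: "n \<ge> 1" and H: "H \<in> events"
  shows "expectation (\<lambda>\<omega>. indicator H \<omega> * \<psi> (E (Suc n) \<omega>)) =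
      (\<Sum>e \<in> Pow (Pow (vertices v n)). \<Sum>y \<in> vertices v n. 
         prob (H \<inter> {\<omega> \<in> space M. E n \<omega> = e} \<inter> {\<omega> \<in> space M. Y n \<omega> = y}) * \<psi> (insert {v (n + 2), y} e))"
proof -
  let ?V = "Pow (Pow (vertices v n))" and ?V' = "Pow (Pow (vertices v (Suc n)))"
  let ?p = "\<lambda>e y. prob (H \<inter> {\<omega> \<in> space M. E n \<omega> = e} \<inter> {\<omega> \<in> space M. Y n \<omega> = y})"
  have "expectation (\<lambda>\<omega>. indicator H \<omega> * \<psi> (E (Suc n) \<omega>)) =
      (\<Sum>e' \<in> ?V'. \<Sum>e \<in> ?V. \<Sum>y \<in> vertices v n.
         if insert {v (n + 2), y} e = e' then \<psi> e' * ?p e y else 0)"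
    using n H by (subst expectation_E(2)) (auto simp: prob_E_Suc sum_distrib_left if_distrib cong: if_cong intro!: sum.cong)
  also have "\<dots> = (\<Sum>e \<in> ?V. \<Sum>e' \<in> ?V'. \<Sum>y \<in> vertices v n.
         if insert {v (n + 2), y} e = e' then \<psi> e' * ?p e y else 0)"
    by (rule sum.swap)
  also have "\<dots> = (\<Sum>e \<in> ?V. \<Sum>y \<in> vertices v n. \<Sum>e' \<in> ?V'.
         if insert {v (n + 2), y} e = e' then \<psi> e' * ?p e y else 0)"
    by (intro sum.cong refl sum.swap)
  also have "\<dots> = (\<Sum>e \<in> ?V. \<Sum>y \<in> vertices v n. ?p e y * \<psi> (insert {v (n + 2), y} e))"
  proof (intro sum.cong refl)
    fix e y assume "e \<in> ?V" "y \<in> vertices v n"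
    then have "insert {v (n + 2), y} e \<in> ?V'" by (auto simp: vertices_Suc)
    then show "(\<Sum>e' \<in> ?V'. if insert {v (n + 2), y} e = e' then \<psi> e' * ?p e y else 0) =
        ?p e y * \<psi> (insert {v (n + 2), y} e)"
      by (subst sum.delta') auto
  qed
  finally show ?thesis .
qed

text \<open>The supermartingale property, stated by integration over past events. For each tree, the
  joint probabilities of the past and the choice are degree biased, so \<open>potential_step\<close>
  applies termwise.\<close>

lemma potential_expectation_step:
  assumes \<beta>: "\<beta> > -1" and n: "n \<ge> 1" and H: "H \<in> sets (history M E n)"
    and large: "\<And>\<omega>. \<omega> \<in> H \<Longrightarrow> real (top_degree n \<omega>) - 1 \<ge> 4 * (2 + \<beta>)"
  shows "expectation (\<lambda>\<omega>. indicator H \<omega> * potential \<beta> v (Suc n) (E (Suc n) \<omega>)) \<le>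
    expectation (\<lambda>\<omega>. indicator H \<omega> * potential \<beta> v n (E n \<omega>))"
proof -
  note Hev = history_events[OF H]
  show ?thesis
    unfolding expectation_E_Suc[OF n Hev] expectation_E(2)[OF n Hev]
  proof (intro sum_mono)
    fix e
    let ?H = "H \<inter> {\<omega> \<in> space M. E n \<omega> = e}"
    let ?q = "\<lambda>y. prob (?H \<inter> {\<omega> \<in> space M. Y n \<omega> = y})"
    have H': "?H \<in> sets (history M E n)"
      using H history_event[OF n order_refl] by (rule sets.Int)
    have sum: "sum ?q (vertices v n) = prob ?H"
      using prob_split_Y[OF n history_events[OF H']] by simp
    show "(\<Sum>y \<in> vertices v n. ?q y * potential \<beta> v (Suc n) (insert {v (n + 2), y} e)) \<le>
        potential \<beta> v n e * prob ?H"
    \<comment> \<open>An edge set that never occurs on \<open>H\<close> need not be a tree, but then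
      its term vanishes.\<close>
    proof (cases "?H = {}")
      case True
      then show ?thesis by (simp only: Int_empty_left measure_empty) simp
    next
      case False
      then obtain \<omega> where \<omega>: "\<omega> \<in> H" "\<omega> \<in> space M" "E n \<omega> = e" by blast
      then have tree: "recursive_tree v n e" using recursive_tree_E[OF n] by blast
      have "degree_biased \<beta> v n e ?q"
        by (rule degree_biased_choice[OF \<beta> n H' _ tree]) auto
      from potential_step[OF \<beta> v_distinct tree this] large[OF \<omega>(1)] \<omega>(3)
      show ?thesis by (simp only: sum mult.commute top_degree_def)
    qed
  qed
qed

section \<open>Growth of the maximal degree\<close>

lemma top_degree_Suc:
  assumes "n \<ge> 1" "\<omega> \<in> space M"
  shows "top_degree (Suc n) \<omega> =
    (if vdegree (E n \<omega>) (Y n \<omega>) = top_degree n \<omega> then Suc (top_degree n \<omega>) else top_degree n \<omega>)"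
  using max_degree_insert[OF v_distinct recursive_tree_E Y_vertices] assms E_Suc[of n \<omega>]
  by (simp add: top_degree_def)

lemma top_degree_mono:
  assumes "1 \<le> m" "m \<le> n" "\<omega> \<in> space M" shows "top_degree m \<omega> \<le> top_degree n \<omega>"
  using assms(2)
proof (induction n rule: dec_induct)
  case (step n)
  then show ?case using top_degree_Suc[of n \<omega>] assms by auto
qed simp

text \<open>As the maximal degree is at least 1, \<open>leader_gain\<close> gives a leader
  conditional probability at least \<open>(1 + \<beta>) / ((2 + \<beta>) * (n + 1))\<close>.
  Truncation at \<open>m\<close> keeps the expectations bounded.\<close>

lemma expectation_top_degree_Suc:
  assumes \<beta>: "\<beta> > -1" and n: "n \<ge> 1"
  shows "expectation (\<lambda>\<omega>. real (min m (top_degree n \<omega>))) +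
      (1 + \<beta>) / (2 + \<beta>) * (1 / real (Suc n)) * prob {\<omega> \<in> space M. top_degree n \<omega> < m}
    \<le> expectation (\<lambda>\<omega>. real (min m (top_degree (Suc n) \<omega>)))"
proof -
  define c where "c = (1 + \<beta>) / (2 + \<beta>) * (1 / real (Suc n))"
  define \<mu> where "\<mu> = (\<lambda>n e. real (min m (max_degree (vertices v n) e)))"
  let ?V = "Pow (Pow (vertices v n))"
  let ?H = "\<lambda>e. {\<omega> \<in> space M. E n \<omega> = e}"
  let ?q = "\<lambda>e y. prob (?H e \<inter> {\<omega> \<in> space M. Y n \<omega> = y})"
  have sp: "space M \<in> events" and int: "space M \<inter> {\<omega> \<in> space M. Q \<omega>} = {\<omega> \<in> space M. Q \<omega>}" for Q by auto
  have ind: "expectation (\<lambda>\<omega>. indicator (space M) \<omega> * f \<omega>) = expectation f" for f :: "'w \<Rightarrow> real"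
    by (intro Bochner_Integration.integral_cong) auto
  have "expectation (\<lambda>\<omega>. \<mu> n (E n \<omega>)) + c * prob {\<omega> \<in> space M. top_degree n \<omega> < m} =
     (\<Sum>e \<in> ?V. \<mu> n e * prob (?H e)) + c * (\<Sum>e \<in> ?V. (if max_degree (vertices v n) e < m then 1 else 0) * prob (?H e))"
  proof -
    have "prob {\<omega> \<in> space M. top_degree n \<omega> < m} =
       expectation (\<lambda>\<omega>. indicator (space M) \<omega> * (if max_degree (vertices v n) (E n \<omega>) < m then 1 else 0))"
      using E_event[OF n, of "\<lambda>e. max_degree (vertices v n) e < m"] unfolding ind top_degree_def
      by (subst Bochner_Integration.integral_cong[OF refl,
            of M _ "indicator {\<omega> \<in> space M. max_degree (vertices v n) (E n \<omega>) < m}"]) (auto simp: Int_absorb2)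
    then show ?thesis
      using expectation_E(2)[OF n sp, of "\<mu> n"] expectation_E(2)[OF n sp, of "\<lambda>e. if max_degree (vertices v n) e < m then 1 else 0"]
      unfolding ind int by simp
  qed
  also have "\<dots> = (\<Sum>e \<in> ?V. (\<mu> n e + (if max_degree (vertices v n) e < m then c else 0)) * prob (?H e))"
    unfolding sum_distrib_left sum.distrib[symmetric] by (intro sum.cong) (auto simp: algebra_simps)
  also have "\<dots> \<le> (\<Sum>e \<in> ?V. \<Sum>y \<in> vertices v n. ?q e y * \<mu> (Suc n) (insert {v (n + 2), y} e))"
  proof (rule sum_mono)
    fix e
    have H: "?H e \<in> sets (history M E n)" by (rule history_event[OF n order_refl])
    have sum: "prob (?H e) = sum (?q e) (vertices v n)"
      by (rule prob_split_Y[OF n history_events[OF H]])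
    show "(\<mu> n e + (if max_degree (vertices v n) e < m then c else 0)) * prob (?H e) \<le>
       (\<Sum>y \<in> vertices v n. ?q e y * \<mu> (Suc n) (insert {v (n + 2), y} e))"
    proof (cases "?H e = {}")
      case True
      then show ?thesis by (simp only: Int_empty_left measure_empty) simp
    next
      case False
      then have tree: "recursive_tree v n e" using recursive_tree_E[OF n] by blast
      let ?m = "max_degree (vertices v n) e"
      have biased: "degree_biased \<beta> v n e (?q e)"
        by (rule degree_biased_choice[OF \<beta> n H _ tree]) auto
      obtain L where L: "L \<in> vertices v n" "vdegree e L = ?m"
        using max_degree_attained[of v n e] by blast
      have m1: "1 \<le> ?m" by (rule max_degree_pos[OF tree])
      \<comment> \<open>Only the choice of the fixed leader \<open>L\<close> is credited; other tied
        leaders can only help.\<close>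
      have up: "\<mu> (Suc n) (insert {v (n + 2), y} e) \<ge> \<mu> n e + (if y = L \<and> ?m < m then 1 else 0)"
        if "y \<in> vertices v n" for y
        using max_degree_insert[OF v_distinct tree that] L by (auto simp: \<mu>_def)
      have "(1 + \<beta>) * prob (?H e) \<le> (real ?m + \<beta>) * prob (?H e)"
        using m1 by (intro mult_right_mono) auto
      also have "\<dots> \<le> ?q e L * ((2 + \<beta>) * real n + \<beta>)"
        using leader_gain[OF \<beta> v_distinct tree biased L] sum by simp
      also have "\<dots> \<le> ?q e L * ((2 + \<beta>) * real (Suc n))"
        by (intro mult_left_mono) (auto simp: algebra_simps)
      finally have gain: "c * prob (?H e) \<le> ?q e L"
        using \<beta> by (simp add: c_def divide_simps mult_ac)
      have "(\<mu> n e + (if ?m < m then c else 0)) * prob (?H e) \<le>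
         \<mu> n e * sum (?q e) (vertices v n) + (if ?m < m then ?q e L else 0)"
        using gain sum by (auto simp: algebra_simps)
      also have "\<dots> = (\<Sum>y \<in> vertices v n. ?q e y * (\<mu> n e + (if y = L \<and> ?m < m then 1 else 0)))"
      proof -
        have "(\<Sum>y \<in> vertices v n. ?q e y * (\<mu> n e + (if y = L \<and> ?m < m then 1 else 0))) =
          (\<Sum>y \<in> vertices v n. \<mu> n e * ?q e y) + (\<Sum>y \<in> vertices v n. if y = L then if ?m < m then ?q e L else 0 else 0)"
          unfolding sum.distrib[symmetric] by (intro sum.cong) (auto simp: algebra_simps)
        then show ?thesis using L(1) by (simp add: sum_distrib_left)
      qed
      also have "\<dots> \<le> (\<Sum>y \<in> vertices v n. ?q e y * \<mu> (Suc n) (insert {v (n + 2), y} e))"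
        using up by (intro sum_mono mult_left_mono) auto
      finally show ?thesis .
    qed
  qed
  also have "\<dots> = expectation (\<lambda>\<omega>. \<mu> (Suc n) (E (Suc n) \<omega>))"
    using expectation_E_Suc[OF n sp, of "\<mu> (Suc n)"] unfolding ind int by simp
  finally show ?thesis by (simp add: c_def \<mu>_def top_degree_def)
qed

text \<open>If the degree stayed below \<open>m\<close> with positive probability, the truncated
  expectation would grow like the harmonic series, although it never exceeds
  \<open>m\<close>.\<close>

lemma AE_top_degree_unbounded:
  assumes \<beta>: "\<beta> > -1"
  shows "AE \<omega> in M. \<forall>m. \<exists>n\<ge>1. m \<le> top_degree n \<omega>"
proof (subst AE_all_countable, intro allI)
  fix m
  define B where "B = {\<omega> \<in> space M. \<forall>n\<ge>1. top_degree n \<omega> < m}"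
  define u where "u = (\<lambda>n. expectation (\<lambda>\<omega>. real (min m (top_degree n \<omega>))))"
  define c where "c = (1 + \<beta>) / (2 + \<beta>)"
  have ev: "{\<omega> \<in> space M. top_degree n \<omega> < m} \<in> events" if "n \<ge> 1" for n
    using E_event[OF that, of "\<lambda>e. max_degree (vertices v n) e < m"] by (simp add: top_degree_def)
  have "B = (\<Inter>n \<in> {1..}. {\<omega> \<in> space M. top_degree n \<omega> < m})" by (auto simp: B_def)
  then have B: "B \<in> events" using ev by auto
  have c: "c > 0" using \<beta> by (simp add: c_def)
  have u: "u n \<le> m" if "n \<ge> 1" for n
  proof -
    have "u n \<le> expectation (\<lambda>\<omega>. real m)"
      unfolding u_def
    proof (rule integral_mono)
      show "integrable M (\<lambda>\<omega>. real (min m (top_degree n \<omega>)))"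
        using expectation_E(1)[OF that sets.top, of "\<lambda>e. real (min m (max_degree (vertices v n) e))"]
        by (simp add: top_degree_def cong: Bochner_Integration.integrable_cong)
    qed auto
    then show ?thesis by (simp add: prob_space)
  qed
  \<comment> \<open>Time starts at 1, so the summands are \<open>1 / 2, 1 / 3, \<dots>\<close>,
    which explains the subtracted 1.\<close>
  have sum: "u 1 + c * prob B * (harm (Suc n) - 1) \<le> u (Suc n)" for n
  proof (induction n)
    case 0
    show ?case by (simp add: harm_expand)
  next
    case (Suc n)
    have "c * prob B * (1 / real (Suc (Suc n))) \<le>
        c * (1 / real (Suc (Suc n))) * prob {\<omega> \<in> space M. top_degree (Suc n) \<omega> < m}"
    proof -
      have "prob B \<le> prob {\<omega> \<in> space M. top_degree (Suc n) \<omega> < m}"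
        using ev[of "Suc n"] by (intro finite_measure_mono) (auto simp: B_def)
      from mult_left_mono[OF this, of "c * (1 / real (Suc (Suc n)))"] c
      show ?thesis by (simp add: mult_ac)
    qed
    also have "\<dots> \<le> u (Suc (Suc n)) - u (Suc n)"
      using expectation_top_degree_Suc[OF \<beta>, of "Suc n" m] by (simp add: u_def c_def)
    finally show ?case
      using Suc by (simp add: harm_Suc[of "Suc n"] algebra_simps inverse_eq_divide)
  qed
  have "u 1 \<ge> 0" unfolding u_def by (intro Bochner_Integration.integral_nonneg) simp
  then have bound: "c * prob B * (harm (Suc n) - 1) \<le> m" for n
    using sum[of n] u[of "Suc n"] by simp
  have "prob B = 0"
  proof (rule ccontr)
    assume "prob B \<noteq> 0"
    then have p: "c * prob B > 0" using c by (simp add: zero_less_measure_iff)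
    have "eventually (\<lambda>n. harm n > m / (c * prob B) + 1) sequentially"
      using harm_at_top by (simp add: filterlim_at_top_dense)
    then obtain N where N: "\<And>n. n \<ge> N \<Longrightarrow> harm n > m / (c * prob B) + 1"
      by (auto simp: eventually_sequentially)
    have "m / (c * prob B) < harm (Suc N) - 1" using N[of "Suc N"] by simp
    then have "m < c * prob B * (harm (Suc N) - 1)"
      using p by (simp add: divide_less_eq mult.commute)
    with bound[of N] show False by simp
  qed
  then have "B \<in> null_sets M" using B by (auto simp: emeasure_eq_measure)
  then have "AE \<omega> in M. \<omega> \<notin> B" by (rule AE_not_in)
  then show "AE \<omega> in M. \<exists>n\<ge>1. m \<le> top_degree n \<omega>"
    using AE_space by eventually_elim (auto simp: B_def not_less)
qed

section \<open>Boundedness of the potential\<close>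

text \<open>Doob's maximal inequality for a nonnegative supermartingale, proved by stopping when
  level \<open>t\<close> is first reached. The starting event \<open>G\<close> ensures that the
  degree is large enough from time \<open>n\<close> on.\<close>

lemma potential_maximal_inequality:
  assumes \<beta>: "\<beta> > -1" and n: "n \<ge> 1" and t: "t > 0"
  defines "G \<equiv> {\<omega> \<in> space M. real (top_degree n \<omega>) - 1 \<ge> 4 * (2 + \<beta>)}"
  shows "t * prob {\<omega> \<in> G. \<exists>k\<ge>n. t \<le> potential \<beta> v k (E k \<omega>)} \<le>
    expectation (\<lambda>\<omega>. indicator G \<omega> * potential \<beta> v n (E n \<omega>))"
proof -
  let ?p = "\<lambda>k \<omega>. potential \<beta> v k (E k \<omega>)"
  \<comment> \<open>The event that level \<open>t\<close> has been reached by time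
    \<open>n + j\<close>.\<close>
  define F where "F = (\<lambda>j. {\<omega> \<in> G. \<exists>k \<in> {n..n + j}. t \<le> ?p k \<omega>})"
  have G: "G \<in> sets (history M E (n + j))" for j
    using history_event[OF n, where n = "n + j" and M = M and E = E
        and Q = "\<lambda>e. real (max_degree (vertices v n) e) - 1 \<ge> 4 * (2 + \<beta>)"]
    by (simp add: G_def top_degree_def)
  have F: "F j \<in> sets (history M E (n + j))" for j
  proof -
    have "F j = (\<Union>k \<in> {n..n + j}. G \<inter> {\<omega> \<in> space M. t \<le> ?p k \<omega>})"
      by (auto simp: F_def G_def)
    also have "\<dots> \<in> sets (history M E (n + j))"
      using n by (intro sets.finite_UN sets.Int G history_event) auto
    finally show ?thesis .
  qed
  have Fev: "F j \<in> events" for j using F history_events by blast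
  have Gev: "G \<in> events" using G history_events by blast
  have nn: "?p k \<omega> \<ge> 0" if "k \<ge> 1" "\<omega> \<in> space M" for k \<omega>
    using potential_nonneg[OF \<beta> recursive_tree_E[OF that]] .
  have int: "integrable M (\<lambda>\<omega>. indicator H \<omega> * ?p k \<omega>)" if "H \<in> events" "k \<ge> 1" for H k
    using expectation_E(1)[OF that(2,1)] .
  \<comment> \<open>On the newly stopped part \<open>A - B\<close> the potential is at least
    \<open>t\<close>, so it can be exchanged for \<open>t\<close> times the probability.\<close>
  have mono: "t * prob (A - B) + expectation (\<lambda>\<omega>. indicator (G - A) \<omega> * ?p k \<omega>) \<le>
      expectation (\<lambda>\<omega>. indicator (G - B) \<omega> * ?p k \<omega>)"
    if k: "k \<ge> 1" and A: "A \<in> events" "A \<subseteq> G" and B: "B \<in> events" "B \<subseteq> A"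
      and le: "\<And>\<omega>. \<omega> \<in> A \<Longrightarrow> \<omega> \<notin> B \<Longrightarrow> t \<le> ?p k \<omega>" for A B k
  proof -
    have AB: "A - B \<in> events" using A B by blast
    have i1: "integrable M (\<lambda>\<omega>. t * indicator (A - B) \<omega>)"
      by (intro integrable_mult_right integrable_event AB)
    have i2: "integrable M (\<lambda>\<omega>. indicator (G - A) \<omega> * ?p k \<omega>)"
      using Gev A by (intro int k) blast
    have i3: "integrable M (\<lambda>\<omega>. indicator (G - B) \<omega> * ?p k \<omega>)"
      using Gev B by (intro int k) blast
    have "t * prob (A - B) + expectation (\<lambda>\<omega>. indicator (G - A) \<omega> * ?p k \<omega>) =
      expectation (\<lambda>\<omega>. t * indicator (A - B) \<omega> + indicator (G - A) \<omega> * ?p k \<omega>)"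
      unfolding Bochner_Integration.integral_add[OF i1 i2]
      using sets.sets_into_space[OF AB] by (simp add: Int_absorb2)
    also have "\<dots> \<le> expectation (\<lambda>\<omega>. indicator (G - B) \<omega> * ?p k \<omega>)"
    proof (rule integral_mono[OF Bochner_Integration.integrable_add[OF i1 i2] i3])
      fix \<omega> assume "\<omega> \<in> space M"
      show "t * indicator (A - B) \<omega> + indicator (G - A) \<omega> * ?p k \<omega> \<le> indicator (G - B) \<omega> * ?p k \<omega>"
        using A B le[of \<omega>] by (cases "\<omega> \<in> A"; cases "\<omega> \<in> B"; cases "\<omega> \<in> G") auto
    qed
    finally show ?thesis .
  qed
  \<comment> \<open>Paths already stopped contribute \<open>t\<close>, the others their current
    potential; this total never exceeds the initial expectation.\<close>
  have main: "t * prob (F j) + expectation (\<lambda>\<omega>. indicator (G - F j) \<omega> * ?p (n + j) \<omega>) \<le>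
     expectation (\<lambda>\<omega>. indicator G \<omega> * ?p n \<omega>)" for j
  proof (induction j)
    case 0
    have "t * prob (F 0 - {}) + expectation (\<lambda>\<omega>. indicator (G - F 0) \<omega> * ?p n \<omega>) \<le>
      expectation (\<lambda>\<omega>. indicator (G - {}) \<omega> * ?p n \<omega>)"
    proof (rule mono[OF n Fev])
      show "F 0 \<subseteq> G" by (auto simp: F_def)
      show "t \<le> ?p n \<omega>" if "\<omega> \<in> F 0" for \<omega> using that by (simp add: F_def)
    qed simp_all
    then show ?case by simp
  next
    case (Suc j)
    have sub: "F j \<subseteq> F (Suc j)" by (force simp: F_def)
    have eq: "prob (F (Suc j)) = prob (F j) + prob (F (Suc j) - F j)"
      using finite_measure_Diff[OF Fev Fev sub] by simp
    have new: "t \<le> ?p (Suc (n + j)) \<omega>" if \<omega>: "\<omega> \<in> F (Suc j)" "\<omega> \<notin> F j" for \<omega>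
    proof -
      obtain k where k: "k \<in> {n..n + Suc j}" "t \<le> ?p k \<omega>" and "\<omega> \<in> G"
        using \<omega> unfolding F_def by blast
      then have "k \<notin> {n..n + j}" using \<omega> unfolding F_def by blast
      with k have "k = Suc (n + j)" by auto
      with k show ?thesis by simp
    qed
    have "t * prob (F (Suc j) - F j) + expectation (\<lambda>\<omega>. indicator (G - F (Suc j)) \<omega> * ?p (Suc (n + j)) \<omega>) \<le>
      expectation (\<lambda>\<omega>. indicator (G - F j) \<omega> * ?p (Suc (n + j)) \<omega>)"
    proof (rule mono[OF _ Fev _ Fev sub])
      show "F (Suc j) \<subseteq> G" by (auto simp: F_def)
    qed (use n new in auto)
    also have "\<dots> \<le> expectation (\<lambda>\<omega>. indicator (G - F j) \<omega> * ?p (n + j) \<omega>)"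
    proof (rule potential_expectation_step[OF \<beta>])
      \<comment> \<open>Not having stopped yet is an event of the past, and on it the degree is
        still large by monotonicity.\<close>
      show "G - F j \<in> sets (history M E (n + j))" using G F by blast
      show "real (top_degree (n + j) \<omega>) - 1 \<ge> 4 * (2 + \<beta>)" if "\<omega> \<in> G - F j" for \<omega>
        using that top_degree_mono[OF n, of "n + j" \<omega>] by (auto simp: G_def)
    qed (use n in simp)
    finally show ?case using Suc eq by (simp add: algebra_simps)
  qed
  have "t * prob (F j) \<le> expectation (\<lambda>\<omega>. indicator G \<omega> * ?p n \<omega>)" for j
  proof -
    have "expectation (\<lambda>\<omega>. indicator (G - F j) \<omega> * ?p (n + j) \<omega>) \<ge> 0"
      using nn n by (intro Bochner_Integration.integral_nonneg) simp
    with main[of j] show ?thesis by linarith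
  qed
  moreover have "(\<lambda>j. t * prob (F j)) \<longlonglongrightarrow> t * prob (\<Union>j. F j)"
    using Fev by (intro tendsto_mult_left finite_Lim_measure_incseq) (force simp: F_def incseq_def)+
  ultimately have "t * prob (\<Union>j. F j) \<le> expectation (\<lambda>\<omega>. indicator G \<omega> * ?p n \<omega>)"
    by (intro LIMSEQ_le_const2) auto
  moreover have "(\<Union>j. F j) = {\<omega> \<in> G. \<exists>k\<ge>n. t \<le> ?p k \<omega>}"
  proof -
    have "\<exists>j. k \<le> n + j" for k by (rule exI[of _ k]) simp
    then show ?thesis by (force simp: F_def)
  qed
  ultimately show ?thesis by simp
qed

text \<open>The probability of exceeding all integer levels is at most \<open>C / (j + 1)\<close>
  for every \<open>j\<close>, by the maximal inequality, hence zero.\<close>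

lemma AE_potential_bounded:
  assumes \<beta>: "\<beta> > -1" and n: "n \<ge> 1"
  shows "AE \<omega> in M. real (top_degree n \<omega>) - 1 \<ge> 4 * (2 + \<beta>) \<longrightarrow>
    (\<exists>t. \<forall>k\<ge>n. potential \<beta> v k (E k \<omega>) < t)"
proof -
  define G where "G = {\<omega> \<in> space M. real (top_degree n \<omega>) - 1 \<ge> 4 * (2 + \<beta>)}"
  define C where "C = expectation (\<lambda>\<omega>. indicator G \<omega> * potential \<beta> v n (E n \<omega>))"
  define B where "B = (\<lambda>t. {\<omega> \<in> G. \<exists>k\<ge>n. t \<le> potential \<beta> v k (E k \<omega>)})"
  have G: "G \<in> events"
    using E_event[OF n, of "\<lambda>e. real (max_degree (vertices v n) e) - 1 \<ge> 4 * (2 + \<beta>)"]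
    by (simp add: G_def top_degree_def)
  have B: "B t \<in> events" for t
  proof -
    have "B t = (\<Union>k \<in> {n..}. G \<inter> {\<omega> \<in> space M. t \<le> potential \<beta> v k (E k \<omega>)})"
      by (auto simp: B_def G_def)
    also have "\<dots> \<in> events"
    proof (rule sets.countable_UN')
      show "(\<lambda>k. G \<inter> {\<omega> \<in> space M. t \<le> potential \<beta> v k (E k \<omega>)}) ` {n..} \<subseteq> events"
        using n by (intro image_subsetI sets.Int G E_event) simp
    qed simp
    finally show ?thesis .
  qed
  define Z where "Z = (\<Inter>j. B (real (Suc j)))"
  have Z: "Z \<in> events" unfolding Z_def using B by blast
  have le: "real (Suc j) * prob Z \<le> C" for j
  proof -
    have "prob Z \<le> prob (B (real (Suc j)))"
      using B by (intro finite_measure_mono) (auto simp: Z_def)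
    then have "real (Suc j) * prob Z \<le> real (Suc j) * prob (B (real (Suc j)))"
      by (intro mult_left_mono) auto
    also have "\<dots> \<le> C"
      unfolding C_def B_def G_def by (rule potential_maximal_inequality[OF \<beta> n]) simp
    finally show ?thesis .
  qed
  have "prob Z = 0"
  proof (rule ccontr)
    assume "prob Z \<noteq> 0"
    then have p: "prob Z > 0" by (simp add: zero_less_measure_iff)
    obtain j where "C / prob Z < real j" using reals_Archimedean2 by blast
    then have "C < real (Suc j) * prob Z" using p by (simp add: divide_less_eq algebra_simps)
    with le[of j] show False by simp
  qed
  then have "Z \<in> null_sets M" using Z by (auto simp: emeasure_eq_measure)
  then have "AE \<omega> in M. \<omega> \<notin> Z" by (rule AE_not_in)
  then show ?thesis
    using AE_space
  proof eventually_elim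
    case (elim \<omega>)
    show ?case
    proof
      assume "real (top_degree n \<omega>) - 1 \<ge> 4 * (2 + \<beta>)"
      then have "\<omega> \<in> G" using elim by (simp add: G_def)
      with elim(1) obtain j where "\<omega> \<notin> B (real (Suc j))" by (auto simp: Z_def)
      with \<open>\<omega> \<in> G\<close> have "\<not> (\<exists>k\<ge>n. real (Suc j) \<le> potential \<beta> v k (E k \<omega>))"
        by (simp add: B_def)
      then have "\<forall>k\<ge>n. potential \<beta> v k (E k \<omega>) < real (Suc j)"
        by (meson not_le)
      then show "\<exists>t. \<forall>k\<ge>n. potential \<beta> v k (E k \<omega>) < t" by blast
    qed
  qed
qed

section \<open>Persistence of the leader\<close>

lemma leads_unique: "leads n \<omega> i \<Longrightarrow> leads n \<omega> j \<Longrightarrow> i = j"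
  by (force simp: leads_def)

text \<open>The old leader could lose its place in one step only if the maximum grew by the choice
  of another vertex of maximal degree, and a strict leader leaves no such vertex.\<close>

lemma leads_Suc:
  assumes n: "n \<ge> 1" and \<omega>: "\<omega> \<in> space M" and i: "leads n \<omega> i" and j: "leads (Suc n) \<omega> j"
  shows "j = i"
proof (rule ccontr)
  assume "j \<noteq> i"
  have vi: "v i \<in> vertices v n" using i by (auto simp: leads_def vertices_def)
  note Suc = E_Suc[OF n \<omega>, simplified]
  note old = vdegree_old[OF v_distinct recursive_tree_E[OF n \<omega>] Y_vertices[OF n \<omega>] vi]
  have deg: "vdegree (E (Suc n) \<omega>) (v i) = top_degree n \<omega> + (if v i = Y n \<omega> then 1 else 0)"
    using old Suc i by (simp add: leads_def)
  have "vdegree (E (Suc n) \<omega>) (v i) < top_degree (Suc n) \<omega>"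
    using j i \<open>j \<noteq> i\<close> by (auto simp: leads_def)
  with deg top_degree_Suc[OF n \<omega>] have Y: "vdegree (E n \<omega>) (Y n \<omega>) = top_degree n \<omega>" "Y n \<omega> \<noteq> v i"
    by (auto split: if_splits)
  obtain k where k: "k \<in> {1..n + 1}" "Y n \<omega> = v k"
    using Y_vertices[OF n \<omega>] by (auto simp: vertices_def)
  with Y have "k \<in> {1..n + 1} - {i}" by auto
  then have "vdegree (E n \<omega>) (v k) < top_degree n \<omega>" using i unfolding leads_def by blast
  with k Y show False by simp
qed

text \<open>The contrapositive of \<open>potential_tie\<close>: a potential below the diagonal value
  leaves no room for a tie.\<close>

lemma leads_exists:
  assumes \<beta>: "\<beta> > -1" and n: "n \<ge> 1" and \<omega>: "\<omega> \<in> space M"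
    and lt: "potential \<beta> v n (E n \<omega>) < urn_kernel \<beta> (top_degree n \<omega>) (top_degree n \<omega>)"
  shows "\<exists>i. leads n \<omega> i"
proof -
  obtain x where "x \<in> vertices v n" "vdegree (E n \<omega>) x = top_degree n \<omega>"
    using max_degree_attained[of v n "E n \<omega>"] by (auto simp: top_degree_def)
  then obtain i where i: "i \<in> {1..n + 1}" "vdegree (E n \<omega>) (v i) = top_degree n \<omega>"
    by (auto simp: vertices_def)
  have "vdegree (E n \<omega>) (v j) < top_degree n \<omega>" if j: "j \<in> {1..n + 1} - {i}" for j
  proof (rule ccontr)
    assume "\<not> ?thesis"
    moreover have "vdegree (E n \<omega>) (v j) \<le> top_degree n \<omega>"
      unfolding top_degree_def using j by (intro max_degree_ge) (auto simp: vertices_def)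
    ultimately have "vdegree (E n \<omega>) (v j) = top_degree n \<omega>" by simp
    moreover have "v i \<noteq> v j" using i j inj_onD[OF v_distinct, of i j] by auto
    ultimately have "urn_kernel \<beta> (top_degree n \<omega>) (top_degree n \<omega>) \<le> potential \<beta> v n (E n \<omega>)"
      using potential_tie[OF \<beta> recursive_tree_E[OF n \<omega>], of "v i" "v j"] i j
      by (auto simp: vertices_def top_degree_def)
    with lt show False by simp
  qed
  with i show ?thesis unfolding leads_def by blast
qed

lemma AE_persistent_hub:
  assumes \<beta>: "\<beta> > -1"
  shows "AE \<omega> in M. \<exists>N i. \<forall>n\<ge>N. leads n \<omega> i"
proof -
  have "AE \<omega> in M. \<forall>n \<in> {1..}. real (top_degree n \<omega>) - 1 \<ge> 4 * (2 + \<beta>) \<longrightarrow>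
    (\<exists>t. \<forall>k\<ge>n. potential \<beta> v k (E k \<omega>) < t)"
    using AE_potential_bounded[OF \<beta>] by (subst AE_ball_countable) auto
  with AE_top_degree_unbounded[OF \<beta>] show ?thesis
    using AE_space
  proof eventually_elim
    case (elim \<omega>)
    obtain m where m: "real m \<ge> 4 * (2 + \<beta>) + 1" using real_arch_simple by blast
    obtain n where n: "n \<ge> 1" "m \<le> top_degree n \<omega>" using elim(1) by blast
    then have "real (top_degree n \<omega>) - 1 \<ge> 4 * (2 + \<beta>)"
      using m by simp
    then obtain t where t: "\<And>k. k \<ge> n \<Longrightarrow> potential \<beta> v k (E k \<omega>) < t"
      using elim(2) n(1) by (metis atLeast_iff)
    have "eventually (\<lambda>a. urn_kernel \<beta> a a \<ge> t) sequentially"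
      using urn_kernel_diagonal_at_top[OF \<beta>] by (simp add: filterlim_at_top)
    then obtain a where a: "\<And>b. b \<ge> a \<Longrightarrow> urn_kernel \<beta> b b \<ge> t"
      by (auto simp: eventually_sequentially)
    obtain n' where n': "n' \<ge> 1" "a \<le> top_degree n' \<omega>" using elim(1) by blast
    \<comment> \<open>From time \<open>n\<close> on the potential is below \<open>t\<close>; from
      time \<open>n'\<close> on the diagonal kernel at the maximal degree is at least
      \<open>t\<close>. After both times there are no ties.\<close>
    define N where "N = max n n'"
    have ex: "\<exists>i. leads k \<omega> i" if k: "k \<ge> N" for k
    proof (rule leads_exists[OF \<beta> _ elim(3)])
      have "a \<le> top_degree k \<omega>"
        using n' top_degree_mono[OF n'(1) _ elim(3), of k] k by (auto simp: N_def)
      then show "potential \<beta> v k (E k \<omega>) < urn_kernel \<beta> (top_degree k \<omega>) (top_degree k \<omega>)"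
        using a[of "top_degree k \<omega>"] t[of k] k by (simp add: N_def)
      show "k \<ge> 1" using k n by (simp add: N_def)
    qed
    then obtain i where i: "leads N \<omega> i" by blast
    have "leads k \<omega> i" if "k \<ge> N" for k
      using that
    proof (induction k rule: dec_induct)
      case base
      show ?case by (rule i)
    next
      case (step k)
      obtain j where j: "leads (Suc k) \<omega> j" using ex[of "Suc k"] step by auto
      moreover have "k \<ge> 1" using step n by (simp add: N_def)
      ultimately show ?case using leads_Suc[OF _ elim(3) step(3)] by blast
    qed
    then show ?case by blast
  qed
qed

text \<open>Time 0 is treated separately: there the edge set is constantly empty, so the event is
  trivial.\<close>

lemma leads_event: "{\<omega> \<in> space M. leads n \<omega> i} \<in> events"
proof (cases "n \<ge> 1")
  case True
  then show ?thesis
    unfolding leads_def top_degree_def by (rule E_event)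
next
  case False
  then have "n = 0" by simp
  then have "{\<omega> \<in> space M. leads n \<omega> i} = (if leads_at_0 then space M else {})"
    if "leads_at_0 = (i = 1 \<and> vdegree {} (v 1) = max_degree (vertices v 0) ({} :: 'v set set))" for leads_at_0
    using that by (auto simp: leads_def top_degree_def E_0)
  then show ?thesis by (metis sets.empty_sets sets.top)
qed

end

theorem proposition1p2:
  fixes M :: "'w measure" and \<beta> :: real and D :: "nat pmf" and v :: "nat \<Rightarrow> 'v"
    and d :: "nat \<Rightarrow> 'w \<Rightarrow> nat" and X :: "nat \<Rightarrow> 'w \<Rightarrow> 'v list" and Y :: "nat \<Rightarrow> 'w \<Rightarrow> 'v"
    and E :: "nat \<Rightarrow> 'w \<Rightarrow> 'v set set"
  assumes "\<beta> > -1"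
    and "set_pmf D \<subseteq> {1..}"
    and "max_choice_mori_tree M \<beta> D v d X Y E"
  shows "\<exists>N K. N \<in> measurable M (count_space (UNIV :: nat set)) \<and>
           K \<in> measurable M (count_space (UNIV :: nat set)) \<and>
           (AE \<omega> in M. \<forall>n \<ge> N \<omega>.
              K \<omega> \<in> {1..n + 1} \<and>
              vdegree (E n \<omega>) (v (K \<omega>)) = max_degree (vertices v n) (E n \<omega>) \<and>
              (\<forall>i \<in> {1..n + 1} - {K \<omega>}.
                 max_degree (vertices v n) (E n \<omega>) > vdegree (E n \<omega>) (v i)))"
proof -
  interpret max_choice_mori_tree M \<beta> D v d X Y E by fact
  have [measurable]: "Measurable.pred M (\<lambda>\<omega>. leads n \<omega> i)" for n i
    using leads_event by (simp add: pred_def)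
  \<comment> \<open>Least indices are measurable functions of countably many events. Where no
    persistent leader exists, they take an unspecified value, which affects a null set only.\<close>
  define N where "N = (\<lambda>\<omega>. LEAST N. \<exists>i. \<forall>n. n \<ge> N \<longrightarrow> leads n \<omega> i)"
  define K where "K = (\<lambda>\<omega>. LEAST i. \<exists>N. \<forall>n. n \<ge> N \<longrightarrow> leads n \<omega> i)"
  have "N \<in> measurable M (count_space UNIV)" "K \<in> measurable M (count_space UNIV)"
    unfolding N_def K_def by measurable
  moreover have "AE \<omega> in M. \<forall>n \<ge> N \<omega>. leads n \<omega> (K \<omega>)"
    using AE_persistent_hub[OF assms(1)]
  proof eventually_elim
    case (elim \<omega>)
    then have "\<exists>i. \<forall>n. n \<ge> N \<omega> \<longrightarrow> leads n \<omega> i"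
      unfolding N_def by (rule LeastI_ex)
    then obtain i where i: "\<And>n. n \<ge> N \<omega> \<Longrightarrow> leads n \<omega> i" by blast
    have "\<exists>i N. \<forall>n. n \<ge> N \<longrightarrow> leads n \<omega> i" using i by blast
    then have "\<exists>N. \<forall>n. n \<ge> N \<longrightarrow> leads n \<omega> (K \<omega>)"
      unfolding K_def by (rule LeastI_ex)
    then obtain N' where "\<And>n. n \<ge> N' \<Longrightarrow> leads n \<omega> (K \<omega>)" by blast
    \<comment> \<open>At a time beyond both thresholds \<open>K \<omega>\<close> and
      \<open>i\<close> lead simultaneously, so uniqueness identifies them.\<close>
    then have "K \<omega> = i"
      using i[of "max (N \<omega>) N'"] leads_unique[of "max (N \<omega>) N'" \<omega>] by simp
    with i show ?case by simp
  qed
  ultimately show ?thesis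
    by (intro exI[of _ N] exI[of _ K]) (simp add: leads_def top_degree_def)
qed

end
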